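(* Let $k$ be a field and let $A$ be a finitely generated $k$-algebra that is an Ore domain. If $A$ does not satisfy a polynomial identity and $K$ is a commutative $k$-subalgebra of the quotient division algebra of $A$, then $\mathrm{GKdim}(K)\le \mathrm{GKdim}(A)-1$.
   Context: An Ore domain is a (not necessarily commutative) domain that satisfies both the left and right Ore conditions, so that it has a quotient division algebra. For a finitely generated $k$-algebra $A$, $\mathrm{GKdim}(A)=\limsup_{n\to\infty}\frac{\log \dim_k V^n}{\log n}$, where $V$ is any finite-dimensional $k$-subspace of $A$ containing $1$ and generating $A$ as a $k$-algebra (the value does not depend on $V$). For a $k$-algebra that is not necessarily finitely generated, $\mathrm{GKdim}$ is the supremum of the Gelfand-Kirillov dimensions of its finitely generated $k$-subalgebras. If $\mathrm{GKdim}(A)=\infty$ the bound is understood as $\infty$, i.e. vacuous. *)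

theory Defs
  imports "HOL-Library.Extended_Real" "HOL-Library.Poly_Mapping"
begin

class ore_domain = ring_1_no_zero_divisors +
  assumes left_ore: "s \<noteq> 0 \<Longrightarrow> \<exists>a' s'. s' \<noteq> 0 \<and> s' * a = a' * s"
    and right_ore: "s \<noteq> 0 \<Longrightarrow> \<exists>a' s'. s' \<noteq> 0 \<and> a * s' = s * a'"

locale k_algebra = vector_space scale
  for scale :: "'k::field \<Rightarrow> 'a::ring_1 \<Rightarrow> 'a" (infixr \<open>*s\<close> 75) +
  assumes scale_mult_left: "(c *s x) * y = c *s (x * y)"
    and scale_mult_right: "x * (c *s y) = c *s (x * y)"
begin

definition subalgebra :: "'a set \<Rightarrow> bool" where
  "subalgebra S \<longleftrightarrow> subspace S \<and> 1 \<in> S \<and> (\<forall>x\<in>S. \<forall>y\<in>S. x * y \<in> S)"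

definition finitely_generated :: "'a set \<Rightarrow> bool" where
  "finitely_generated S \<longleftrightarrow> (\<exists>X. finite X \<and> subalgebra hull X = S)"

definition finite_dimensional :: "'a set \<Rightarrow> bool" where
  "finite_dimensional V \<longleftrightarrow> subspace V \<and> (\<exists>B. finite B \<and> span B = V)"

text \<open>The subspace \<open>V\<^sup>n\<close> spanned by all products of \<open>n\<close> elements of \<open>V\<close>.\<close>

definition space_power :: "'a set \<Rightarrow> nat \<Rightarrow> 'a set" where
  "space_power V n = span {prod_list xs | xs. length xs = n \<and> set xs \<subseteq> V}"

definition generating_space :: "'a set \<Rightarrow> 'a set \<Rightarrow> bool" where
  "generating_space S V \<longleftrightarrow> finite_dimensional V \<and> 1 \<in> V \<and> subalgebra hull V = S"

definition growth_exponent :: "'a set \<Rightarrow> ereal" where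
  "growth_exponent V = limsup (\<lambda>n. ereal (ln (real (dim (space_power V n))) / ln (real n)))"

text \<open>The choice of the generating space is immaterial, see \<open>fg_GKdim_eq\<close> below.\<close>

definition fg_GKdim :: "'a set \<Rightarrow> ereal" where
  "fg_GKdim S = growth_exponent (SOME V. generating_space S V)"

text \<open>On finitely generated subalgebras this agrees with \<^term>\<open>fg_GKdim\<close>, see
  \<open>GKdim_eq_fg_GKdim\<close> below.\<close>

definition GKdim :: "'a set \<Rightarrow> ereal" where
  "GKdim S = (SUP B\<in>{B. subalgebra B \<and> finitely_generated B \<and> B \<subseteq> S}. fg_GKdim B)"

text \<open>Elements of the free algebra \<open>k\<langle>x\<^sub>0, x\<^sub>1, \<dots>\<rangle>\<close> are finitely supported maps from words
  in the indices of the variables to \<open>k\<close>.\<close>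

definition nc_poly_eval :: "(nat list \<Rightarrow>\<^sub>0 'k) \<Rightarrow> (nat \<Rightarrow> 'a) \<Rightarrow> 'a" where
  "nc_poly_eval f x = (\<Sum>w\<in>Poly_Mapping.keys f. Poly_Mapping.lookup f w *s prod_list (map x w))"

definition satisfies_polynomial_identity :: bool where
  "satisfies_polynomial_identity \<longleftrightarrow> (\<exists>f. f \<noteq> 0 \<and> (\<forall>x. nc_poly_eval f x = 0))"

end

text \<open>\<open>D\<close>, the whole type \<open>'d\<close>, is a quotient division algebra of the Ore domain \<open>A\<close>, the whole
  type \<open>'a\<close>, via the embedding \<open>\<iota>\<close>. It is determined by \<open>A\<close> up to unique isomorphism over \<open>A\<close>.\<close>

locale quotient_division_algebra =
  A: k_algebra scaleA + D: k_algebra scaleD + Vector_Spaces.linear scaleA scaleD \<iota>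
  for scaleA :: "'k::field \<Rightarrow> 'a::ore_domain \<Rightarrow> 'a"
    and scaleD :: "'k \<Rightarrow> 'd::division_ring \<Rightarrow> 'd"
    and \<iota> :: "'a \<Rightarrow> 'd" +
  assumes embed_mult: "\<iota> (a * b) = \<iota> a * \<iota> b"
    and embed_one: "\<iota> 1 = 1"
    and embed_inj: "inj \<iota>"
    and right_fraction: "\<exists>a s. s \<noteq> 0 \<and> d = \<iota> a * inverse (\<iota> s)"
    and left_fraction: "\<exists>a s. s \<noteq> 0 \<and> d = inverse (\<iota> s) * \<iota> a"

context k_algebra
begin

lemma subalgebra_hull: "subalgebra (subalgebra hull X)"
  by (rule hull_in) (auto simp: subalgebra_def intro: subspace_Inter)

lemma space_power_mult:
  assumes "x \<in> space_power V m" "y \<in> space_power V n"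
  shows "x * y \<in> space_power V (m + n)"
proof -
  let ?P = "\<lambda>n. {prod_list xs | xs. length xs = n \<and> set xs \<subseteq> V}"
  have 1: "p * y \<in> span (?P (m + n))" if "p \<in> ?P m" for p
    using assms(2)[unfolded space_power_def]
  proof (induction rule: span_induct_alt)
    case base then show ?case by (simp add: span_zero)
  next
    case (step c q z)
    from that step(1) obtain xs ys where "p = prod_list xs" "q = prod_list ys"
      "length xs = m" "length ys = n" "set xs \<subseteq> V" "set ys \<subseteq> V" by auto
    then have "p * q \<in> ?P (m + n)" by (intro CollectI exI[of _ "xs @ ys"]) auto
    then show ?case using step(2)
      by (simp add: distrib_left scale_mult_right span_add span_scale span_base)
  qed
  show ?thesis using assms(1) unfolding space_power_def
  proof (induction rule: span_induct_alt)
    case base then show ?case by (simp add: span_zero)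
  next
    case (step c q z)
    then show ?case using 1[OF step(1)]
      by (simp add: distrib_right scale_mult_left span_add span_scale)
  qed
qed

lemma space_power_mono_exp:
  assumes "1 \<in> V" "m \<le> n"
  shows "space_power V m \<subseteq> space_power V n"
  unfolding space_power_def
proof (rule span_mono, safe)
  fix xs :: "'a list" assume "set xs \<subseteq> V" "m = length xs"
  then show "\<exists>ys. prod_list xs = prod_list ys \<and> length ys = n \<and> set ys \<subseteq> V"
    using assms by (intro exI[of _ "xs @ replicate (n - m) 1"]) (auto simp: prod_list_replicate)
qed

lemma prod_list_space_power:
  assumes "set xs \<subseteq> space_power V m"
  shows "prod_list xs \<in> space_power V (m * length xs)"
  using assms
proof (induction xs)
  case Nil
  have "prod_list [] \<in> space_power V 0"
    unfolding space_power_def by (intro span_base CollectI exI[of _ "[]"]) auto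
  then show ?case by simp
next
  case (Cons x xs)
  then show ?case using space_power_mult[of x V m "prod_list xs" "m * length xs"] by simp
qed

lemma space_power_power:
  assumes "W \<subseteq> space_power V m"
  shows "space_power W n \<subseteq> space_power V (m * n)"
proof -
  have "prod_list xs \<in> space_power V (m * n)" if "length xs = n" "set xs \<subseteq> W" for xs
    using prod_list_space_power[of xs V m] that assms by auto
  then show ?thesis
    unfolding space_power_def[of W]
    by (intro span_minimal) (auto simp: space_power_def)
qed

lemma subset_space_power_1: "V \<subseteq> space_power V 1"
proof
  fix v assume "v \<in> V"
  then show "v \<in> space_power V 1"
    unfolding space_power_def by (intro span_base CollectI exI[of _ "[v]"]) auto
qed

lemma finite_dimensional_space_power:
  assumes "finite_dimensional V"
  shows "finite_dimensional (space_power V n)"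
proof -
  obtain B where B: "finite B" "span B = V" using assms by (auto simp: finite_dimensional_def)
  let ?C = "{prod_list xs | xs. length xs = n \<and> set xs \<subseteq> B}"
  have "?C = prod_list ` {xs. set xs \<subseteq> B \<and> length xs = n}" by auto
  then have "finite ?C" using finite_lists_length_eq[OF B(1)] by simp
  have "V \<subseteq> space_power B 1"
    using B(2) subset_space_power_1[of B] span_minimal[of B "space_power B 1"]
    by (auto simp: space_power_def)
  from space_power_power[OF this, of n] have "space_power V n \<subseteq> space_power B n" by simp
  moreover have "space_power B n \<subseteq> space_power V n"
    using B span_superset[of B] unfolding space_power_def by (intro span_mono) blast
  ultimately have "span ?C = space_power V n" by (auto simp: space_power_def[of B])
  with \<open>finite ?C\<close> have "\<exists>C. finite C \<and> span C = space_power V n" by (intro exI[of _ ?C] conjI)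
  moreover have "subspace (space_power V n)" unfolding space_power_def by (rule subspace_span)
  ultimately show ?thesis unfolding finite_dimensional_def by (intro conjI)
qed

lemma subalgebra_hull_eq_Union:
  assumes "1 \<in> V"
  shows "subalgebra hull V = (\<Union>n. space_power V n)"
proof (rule hull_unique)
  show "V \<subseteq> (\<Union>n. space_power V n)" using subset_space_power_1[of V] by blast
  show "subalgebra (\<Union>n. space_power V n)"
    unfolding subalgebra_def subspace_def
  proof (intro conjI ballI allI)
    show "0 \<in> (\<Union>n. space_power V n)" by (auto simp: space_power_def span_zero)
    show "1 \<in> (\<Union>n. space_power V n)" using subset_space_power_1[of V] assms by blast
  next
    fix x y assume "x \<in> (\<Union>n. space_power V n)" "y \<in> (\<Union>n. space_power V n)"
    then obtain m n where mn: "x \<in> space_power V m" "y \<in> space_power V n" by auto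
    have "x * y \<in> space_power V (m + n)" by (rule space_power_mult[OF mn])
    then show "x * y \<in> (\<Union>n. space_power V n)" by (rule UN_I[OF UNIV_I])
    have "x \<in> space_power V (max m n)" "y \<in> space_power V (max m n)"
      using mn space_power_mono_exp[OF assms, of m "max m n"]
        space_power_mono_exp[OF assms, of n "max m n"] by auto
    then have "x + y \<in> space_power V (max m n)" by (simp add: space_power_def span_add)
    then show "x + y \<in> (\<Union>n. space_power V n)" by (rule UN_I[OF UNIV_I])
  next
    fix c x assume "x \<in> (\<Union>n. space_power V n)"
    then show "c *s x \<in> (\<Union>n. space_power V n)" by (auto simp: space_power_def intro: span_scale)
  qed
next
  fix S assume S: "V \<subseteq> S" "subalgebra S"
  have "prod_list xs \<in> S" if "set xs \<subseteq> V" for xs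
    using that S by (induction xs) (auto simp: subalgebra_def)
  then show "(\<Union>n. space_power V n) \<subseteq> S"
    using S(2) unfolding space_power_def
    by (intro UN_least span_minimal) (auto simp: subalgebra_def)
qed

lemma finite_dimensional_subset_space_power:
  assumes "finite_dimensional W" "1 \<in> V" "W \<subseteq> subalgebra hull V"
  shows "\<exists>m\<ge>1. W \<subseteq> space_power V m"
proof -
  obtain B where B: "finite B" "span B = W" using assms by (auto simp: finite_dimensional_def)
  have "\<forall>b\<in>B. \<exists>n. b \<in> space_power V n"
    using B(2) span_superset[of B] assms(3) by (auto simp: subalgebra_hull_eq_Union[OF assms(2)])
  then obtain f where f: "\<And>b. b \<in> B \<Longrightarrow> b \<in> space_power V (f b)" by metis
  define m where "m = Max (insert 1 (f ` B))"
  have "1 \<le> m" "\<And>b. b \<in> B \<Longrightarrow> f b \<le> m" using B(1) by (auto simp: m_def)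
  then have "B \<subseteq> space_power V m" using f space_power_mono_exp[OF assms(2), of _ m] by blast
  then have "W \<subseteq> space_power V m"
    using B(2) span_minimal[of B "space_power V m"] by (auto simp: space_power_def)
  with \<open>1 \<le> m\<close> show ?thesis by blast
qed

lemma dim_mono:
  assumes "finite_dimensional V" "W \<subseteq> V"
  shows "dim W \<le> dim V"
proof -
  obtain C where C: "finite C" "span C = V" using assms by (auto simp: finite_dimensional_def)
  obtain B where B: "B \<subseteq> V" "independent B" "V \<subseteq> span B" "card B = dim V"
    using basis_exists[of V] by blast
  have "finite B" using independent_span_bound[of C B] B C by auto
  with B assms(2) show ?thesis using dim_le_card[of W B] by auto
qed

lemma dim_space_power_pos:
  assumes "finite_dimensional V" "1 \<in> V"
  shows "dim (space_power V n) \<ge> 1"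
proof -
  have "1 \<in> space_power V n"
    unfolding space_power_def using assms(2)
    by (intro span_base CollectI exI[of _ "replicate n 1"]) (auto simp: prod_list_replicate)
  then have "dim {1} \<le> dim (space_power V n)"
    by (intro dim_mono finite_dimensional_space_power assms) auto
  moreover have "independent {1::'a}" by simp
  ultimately show ?thesis using dim_eq_card_independent[of "{1::'a}"] by simp
qed

lemma growth_exponent_nonneg:
  assumes "finite_dimensional V" "1 \<in> V"
  shows "growth_exponent V \<ge> 0"
proof -
  have "(0::ereal) \<le> liminf (\<lambda>n. ereal (ln (real (dim (space_power V n))) / ln (real n)))"
    using dim_space_power_pos[OF assms] by (intro Liminf_bounded eventually_sequentiallyI[of 2]) simp
  also have "\<dots> \<le> growth_exponent V"
    unfolding growth_exponent_def by (rule Liminf_le_Limsup) simp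
  finally show ?thesis .
qed

lemma growth_exponent_mono:
  assumes V: "finite_dimensional V" "1 \<in> V"
    and W: "finite_dimensional W" "1 \<in> W" "W \<subseteq> subalgebra hull V"
  shows "growth_exponent W \<le> growth_exponent V"
proof (rule dense_ge)
  fix t assume t: "growth_exponent V < t"
  obtain m where m: "m \<ge> 1" "W \<subseteq> space_power V m"
    using finite_dimensional_subset_space_power[OF W(1) V(2) W(3)] by blast
  show "growth_exponent W \<le> t"
  proof (cases t)
    case PInf then show ?thesis by simp
  next
    case MInf then show ?thesis using t by simp
  next
    case (real c)
    let ?g = "\<lambda>V n. ln (real (dim (space_power V n))) / ln (real n)"
    have "eventually (\<lambda>n. ereal (?g V n) < t) sequentially"
      using t unfolding growth_exponent_def by (rule Limsup_lessD)
    then obtain N where N: "\<And>n. n \<ge> N \<Longrightarrow> ?g V n < c"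
      using real by (auto simp: eventually_sequentially)
    let ?h = "\<lambda>n. c * (ln (real m) / ln (real n) + 1)"
    have le: "?g W n \<le> ?h n" if n: "n \<ge> max N 2" for n
    proof -
      have "1 * n \<le> m * n" using m(1) by (rule mult_le_mono1)
      then have mn: "m * n \<ge> N" "m * n \<ge> 2" using n by linarith+
      have pos: "ln (real n) > 0" "ln (real (m * n)) > 0" using n mn(2) by (intro ln_gt_zero; linarith)+
      have "dim (space_power W n) \<le> dim (space_power V (m * n))"
        by (intro dim_mono finite_dimensional_space_power V space_power_power m)
      then have "ln (real (dim (space_power W n))) \<le> ln (real (dim (space_power V (m * n))))"
        using dim_space_power_pos[OF W(1,2), of n] dim_space_power_pos[OF V, of "m * n"]
        by simp
      also have "\<dots> \<le> c * ln (real (m * n))"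
        using N[OF mn(1)] pos(2) by (simp only: pos_divide_less_eq less_imp_le)
      also have "\<dots> = c * (ln (real m) + ln (real n))"
        using m n by (simp add: ln_mult)
      finally have "?g W n \<le> c * (ln (real m) + ln (real n)) / ln (real n)"
        using pos(1) by (simp add: divide_right_mono)
      also have "\<dots> = ?h n" using pos(1) by (simp add: field_simps)
      finally show ?thesis .
    qed
    have "(\<lambda>n. ln (real m) / ln (real n)) \<longlonglongrightarrow> 0"
      by (intro tendsto_divide_0[OF tendsto_const] filterlim_at_top_imp_at_infinity
            filterlim_compose[OF ln_at_top filterlim_real_sequentially])
    then have "?h \<longlonglongrightarrow> c * (0 + 1)" by (intro tendsto_intros)
    then have "(\<lambda>n. ereal (?h n)) \<longlonglongrightarrow> ereal c" by simp
    then have "limsup (\<lambda>n. ereal (?h n)) = ereal c" by (intro lim_imp_Limsup) auto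
    moreover have "growth_exponent W \<le> limsup (\<lambda>n. ereal (?h n))"
      unfolding growth_exponent_def
      using le by (intro Limsup_mono eventually_sequentiallyI[of "max N 2"]) simp
    ultimately show ?thesis using real by simp
  qed
qed

lemma finitely_generated_iff: "finitely_generated S \<longleftrightarrow> (\<exists>V. generating_space S V)"
proof
  assume "finitely_generated S"
  then obtain X where X: "finite X" "subalgebra hull X = S" by (auto simp: finitely_generated_def)
  let ?V = "span (insert 1 X)"
  have "subalgebra hull ?V = S"
  proof (rule hull_unique)
    have "X \<subseteq> S" using X(2) hull_subset[of X subalgebra] by simp
    moreover show S: "subalgebra S" using X(2) subalgebra_hull[of X] by simp
    ultimately show "?V \<subseteq> S" by (intro span_minimal) (simp_all add: subalgebra_def)
    fix T assume "?V \<subseteq> T" "subalgebra T"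
    moreover have "X \<subseteq> ?V" using span_superset[of "insert 1 X"] by simp
    ultimately show "S \<subseteq> T" using X(2) hull_minimal[of X T subalgebra] by simp
  qed
  moreover have "finite_dimensional ?V" unfolding finite_dimensional_def
    using X(1) by (intro conjI subspace_span exI[of _ "insert 1 X"]) simp_all
  ultimately have "generating_space S ?V" by (simp add: generating_space_def span_base)
  then show "\<exists>V. generating_space S V" by blast
next
  assume "\<exists>V. generating_space S V"
  then obtain V B where V: "1 \<in> V" "subalgebra hull V = S" "finite B" "span B = V"
    by (auto simp: generating_space_def finite_dimensional_def)
  have "subalgebra hull B = S"
  proof (rule hull_unique)
    show "B \<subseteq> S" using V(2,4) span_superset[of B] hull_subset[of V subalgebra] by simp
    show "subalgebra S" using V(2) subalgebra_hull[of V] by simp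
    fix T assume "B \<subseteq> T" "subalgebra T"
    then have "span B \<subseteq> T" by (intro span_minimal) (simp_all add: subalgebra_def)
    then show "S \<subseteq> T" using V(2,4) \<open>subalgebra T\<close> hull_minimal[of V T subalgebra] by simp
  qed
  with V(3) show "finitely_generated S" unfolding finitely_generated_def by blast
qed

theorem fg_GKdim_eq:
  assumes "generating_space S V"
  shows "fg_GKdim S = growth_exponent V"
proof -
  have "generating_space S (SOME V. generating_space S V)" using assms by (rule someI)
  then show ?thesis
    using assms unfolding fg_GKdim_def generating_space_def
    by (intro antisym growth_exponent_mono) (auto intro: hull_inc)
qed

theorem GKdim_eq_fg_GKdim:
  assumes "finitely_generated S"
  shows "GKdim S = fg_GKdim S"
  unfolding GKdim_def
proof (rule antisym[OF SUP_least SUP_upper])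
  have "subalgebra S" using assms subalgebra_hull by (auto simp: finitely_generated_def)
  then show "S \<in> {B. subalgebra B \<and> finitely_generated B \<and> B \<subseteq> S}" using assms by simp
  fix B assume "B \<in> {B. subalgebra B \<and> finitely_generated B \<and> B \<subseteq> S}"
  then obtain W V where WV: "generating_space B W" "generating_space S V" "B \<subseteq> S"
    using assms by (auto simp: finitely_generated_iff)
  then have "growth_exponent W \<le> growth_exponent V"
    unfolding generating_space_def using hull_subset[of W subalgebra]
    by (intro growth_exponent_mono) auto
  then show "fg_GKdim B \<le> fg_GKdim S" using WV by (simp add: fg_GKdim_eq)
qed

end

end

theory Submission
  imports Defs "HOL-Combinatorics.Permutations" "HOL-Real_Asymp.Real_Asymp"
begin

text \<open>
  Let \<open>D\<close> be the quotient division algebra of \<open>A\<close>. A commutative subset of \<open>D\<close> lies in a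
  commutative subfield \<open>F\<close>, namely its bicommutant. Let \<open>W\<close> be a finite-dimensional subspace of \<open>K\<close>
  that contains \<open>1\<close>, and let \<open>V\<close> be a generating space of \<open>A\<close> that is large enough to contain \<open>s W\<close>
  for a common left denominator \<open>s\<close> of \<open>W\<close>. The heart of the proof is the dichotomy
  \<open>dim_space_power_dichotomy\<close>: for all \<open>m > 0\<close> and \<open>j\<close>, with \<open>n = m j\<close>,
  either \<open>dim V\<^sup>2\<^sup>n \<ge> 2\<^sup>j\<close> or \<open>2 dim V\<^sup>2\<^sup>n \<ge> (n + 1) dim W\<^sup>m\<close>.
  If \<open>j\<close> is about \<open>(ln m)\<^sup>2\<close> and \<open>A\<close> has polynomial growth, the first alternative fails for large
  \<open>m\<close>, and the second one says that \<open>V\<close> grows faster than \<open>W\<close> by a full factor of \<open>n\<close>, up to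
  logarithmic factors; this is \<open>growth_comparison\<close>.

  The dichotomy comes from a linear version of an inequality of Petridis in additive combinatorics,
  \<open>dim_sum_of_translates_le\<close>. For a finite-dimensional \<open>T\<close>, choose \<open>U\<close> to minimise the ratio
  \<open>r = dim (T U) / dim U\<close> among the subspaces of a given space. Then every finite sum \<open>Y\<close> of images of
  \<open>U\<close> under injective linear maps that commute with left multiplication by \<open>T\<close> still satisfies
  \<open>dim (T Y) \<le> r dim Y\<close>. It is used twice, with maps on either side of \<open>U\<close>.

  \<^item> Suppose that left multiplication by \<open>W\<^sup>m\<close> at least doubles the dimension of each subspace of
    \<open>V\<^sup>i\<close>, for all \<open>i < n\<close>. As \<open>W\<close> is commutative, the maps may be multiplications by elements of
    powers of \<open>W\<close>, so \<open>dim (W\<^sup>m U) \<le> r\<^sup>m dim U\<close> for the minimal ratio \<open>r\<close> of \<open>W\<close> on \<open>V\<^sup>i\<close>. Hence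
    \<open>r\<^sup>m \<ge> 2\<close>. From \<open>s W V\<^sup>i \<subseteq> V\<^sup>i\<^sup>+\<^sup>1\<close> it follows that \<open>dim V\<^sup>i\<^sup>+\<^sup>1 \<ge> r dim V\<^sup>i\<close>, and the first
    alternative results from \<open>n\<close> such steps.

  \<^item> Otherwise some subspace \<open>Z\<close> of some \<open>V\<^sup>i\<close> has \<open>dim (W\<^sup>m Z) < 2 dim Z\<close>. Right multiplication
    commutes with left multiplication, so the inequality with \<open>T = W\<^sup>m\<close> and right multiplications by
    elements of \<open>V\<^sup>n\<close> yields a nonzero \<open>u \<in> Z\<close> with \<open>dim (W\<^sup>m u V\<^sup>n) \<le> 2 dim (Z V\<^sup>n) \<le> 2 dim V\<^sup>2\<^sup>n\<close>.
    But \<open>u V\<^sup>n\<close> contains \<open>n + 1\<close> elements that are left linearly independent over \<open>F\<close>, and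
    \<open>W\<^sup>m \<subseteq> F\<close>, so the left-hand side is at least \<open>(n + 1) dim W\<^sup>m\<close>.

  The absence of a polynomial identity enters in the last step: if \<open>u V\<^sup>n\<close> had too few independent
  elements, then \<open>u A\<close> would lie in a finite-dimensional left \<open>F\<close>-space that is stable under right
  multiplication by \<open>A\<close>, and \<open>A\<close> would act faithfully by matrices over \<open>F\<close>
  (\<open>exists_left_independent_translates\<close>). Matrices over a commutative ring satisfy a standard identity.
\<close>

section \<open>Finite-dimensional subspaces\<close>

context k_algebra
begin

lemma finite_dimensionalI: "finite B \<Longrightarrow> finite_dimensional (span B)"
  unfolding finite_dimensional_def by (intro conjI subspace_span exI[of _ B] refl)

lemma finite_dimensional_subspace: "finite_dimensional V \<Longrightarrow> subspace V"
  by (simp add: finite_dimensional_def)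

lemma finite_dimensional_obtain_basis:
  assumes "finite_dimensional V"
  obtains B where "finite B" "independent B" "B \<subseteq> V" "span B = V" "card B = dim V"
proof -
  obtain C where C: "finite C" "span C = V" using assms by (auto simp: finite_dimensional_def)
  obtain B where B: "B \<subseteq> V" "independent B" "V \<subseteq> span B" "card B = dim V"
    using basis_exists[of V] by blast
  have "finite B" using independent_span_bound[of C B] B C by auto
  moreover have "span B = V"
    using B span_minimal[of B V] assms by (auto simp: finite_dimensional_def)
  ultimately show ?thesis using that B by blast
qed

lemma finite_independent_subset:
  assumes "finite_dimensional V" "independent B" "B \<subseteq> V"
  shows "finite B"
proof -
  obtain C where "finite C" "span C = V" using assms by (auto simp: finite_dimensional_def)
  then show ?thesis using independent_span_bound[of C B] assms by auto
qed

lemma finite_dimensional_subset: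
  assumes "finite_dimensional V" "subspace S" "S \<subseteq> V"
  shows "finite_dimensional S"
proof -
  obtain B where B: "B \<subseteq> S" "independent B" "S \<subseteq> span B" "card B = dim S"
    using basis_exists[of S] by blast
  have "finite B" using finite_independent_subset[OF assms(1) B(2)] B(1) assms(3) by blast
  moreover have "span B = S" using B(3) span_minimal[OF B(1) assms(2)] by (rule antisym[rotated])
  ultimately show ?thesis using finite_dimensionalI by blast
qed

text \<open>The dimension formula \<open>dim (S + T) + dim (S \<inter> T) = dim S + dim T\<close>, with the union in place of
  the sum: \<^const>\<open>dim\<close> of a set is the dimension of its span.\<close>

lemma dim_Un_Int:
  assumes S: "finite_dimensional S" and T: "finite_dimensional T"
  shows "dim (S \<union> T) + dim (S \<inter> T) = dim S + dim T"
proof -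
  have sub: "subspace S" "subspace T" using assms finite_dimensional_subspace by auto
  have fdI: "finite_dimensional (S \<inter> T)"
    using finite_dimensional_subset[OF S subspace_inter[OF sub]] by blast
  obtain B where B: "finite B" "independent B" "B \<subseteq> S \<inter> T" "span B = S \<inter> T" "card B = dim (S \<inter> T)"
    using finite_dimensional_obtain_basis[OF fdI] by blast
  obtain C where C: "B \<subseteq> C" "C \<subseteq> S" "independent C" "S \<subseteq> span C"
    using maximal_independent_subset_extend[of B S] B by blast
  obtain D where D: "B \<subseteq> D" "D \<subseteq> T" "independent D" "T \<subseteq> span D"
    using maximal_independent_subset_extend[of B T] B by blast
  have fin: "finite C" "finite D"
    using finite_independent_subset[OF S C(3,2)] finite_independent_subset[OF T D(3,2)] by auto
  have spC: "span C = S" and spD: "span D = T"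
    using C D sub span_minimal[of C S] span_minimal[of D T] by auto
  \<comment> \<open>The basis \<open>C\<close> of \<open>S\<close> is extended by the vectors of \<open>D - B\<close> one at a time; a dependence would put
    a vector of \<open>S\<close> into \<open>S \<inter> T = span B\<close> and contradict the independence of \<open>D\<close>.\<close>
  have "D' \<subseteq> D - B \<Longrightarrow> independent (C \<union> D') \<and> C \<inter> D' = {}" if "finite D'" for D'
    using that
  proof (induction D')
    case empty then show ?case using C by simp
  next
    case (insert x D')
    have "x \<notin> span (C \<union> D')"
    proof
      assume "x \<in> span (C \<union> D')"
      then obtain c d where cd: "x = c + d" "c \<in> S" "d \<in> span D'"
        unfolding span_Un spC by blast
      have "d \<in> T" using cd(3) span_mono[of D' D] spD insert.prems by auto
      moreover have "x \<in> T" using insert.prems D by auto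
      ultimately have "c \<in> span B" using subspace_diff[OF sub(2), of x d] cd(1,2) B(4) by simp
      then have "x \<in> span (B \<union> D')" using cd(1,3) unfolding span_Un by blast
      then have "x \<in> span (D - {x})"
        using span_mono[of "B \<union> D'" "D - {x}"] insert.prems insert.hyps(2) D(1) by blast
      then show False using D(3) insert.prems by (auto simp: dependent_def)
    qed
    moreover have "x \<notin> C" using calculation span_base[of x "C \<union> D'"] by auto
    ultimately show ?case using insert by (auto simp: independent_insert)
  qed
  from this[of "D - B"] have *: "independent (C \<union> (D - B))" "C \<inter> (D - B) = {}" using fin by auto
  have "C \<union> (D - B) = C \<union> D" using C by blast
  moreover have "span S = S" "span T = T" using sub by (simp_all add: span_eq_iff)
  ultimately have "span (S \<union> T) = span (C \<union> (D - B))" by (simp only: span_Un spC spD)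
  then have 1: "dim (S \<union> T) = card (C \<union> (D - B))"
    using *(1) dim_eq_card by blast
  have 2: "card (C \<union> (D - B)) = card C + (card D - card B)"
    using * fin B D by (simp add: card_Un_disjoint card_Diff_subset)
  have 3: "card C = dim S" "card D = dim T"
    using dim_eq_card_independent[OF C(3)] dim_eq_card_independent[OF D(3)]
      dim_span[of C] dim_span[of D] spC spD by auto
  have "card B \<le> card D" using D fin by (intro card_mono) auto
  then show ?thesis using B(5) 1 2 3 by linarith
qed

end

lemma dim_image_inj:
  assumes s: "k_algebra s1" "k_algebra s2"
    and f: "Vector_Spaces.linear s1 s2 f" "inj f" and V: "k_algebra.finite_dimensional s1 V"
  shows "vector_space.dim s2 (f ` V) = vector_space.dim s1 V"
    "k_algebra.finite_dimensional s2 (f ` V)"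
proof -
  interpret A: k_algebra s1 by (rule s)
  interpret B: k_algebra s2 by (rule s)
  interpret f: Vector_Spaces.linear s1 s2 f by (rule f)
  obtain B where B: "finite B" "A.independent B" "B \<subseteq> V" "A.span B = V" "card B = A.dim V"
    by (rule A.finite_dimensional_obtain_basis[OF V])
  have img: "B.span (f ` B) = f ` V" using f.span_image[of B] B by simp
  then show "B.finite_dimensional (f ` V)" using B.finite_dimensionalI[of "f ` B"] B by simp
  have "B.independent (f ` B)"
    using f.independent_injective_image[OF B(2)] f(2) by (auto simp: inj_on_def)
  then have "B.dim (f ` V) = card (f ` B)" using img B.dim_span_eq_card_independent by metis
  then show "B.dim (f ` V) = A.dim V" using B f(2) by (simp add: card_image inj_on_subset)
qed

section \<open>Products of subspaces\<close>

context k_algebra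
begin

definition span_times :: "'a set \<Rightarrow> 'a set \<Rightarrow> 'a set" (infixr "\<odot>" 72) where
  "S \<odot> T = span {x * y | x y. x \<in> S \<and> y \<in> T}"

lemma span_timesI: "x \<in> S \<Longrightarrow> y \<in> T \<Longrightarrow> x * y \<in> S \<odot> T"
  unfolding span_times_def by (rule span_base) blast

lemma subspace_span_times [simp]: "subspace (S \<odot> T)"
  unfolding span_times_def by (rule subspace_span)

lemma span_times_least:
  assumes "subspace U" "\<And>x y. x \<in> S \<Longrightarrow> y \<in> T \<Longrightarrow> x * y \<in> U"
  shows "S \<odot> T \<subseteq> U"
  unfolding span_times_def using assms by (intro span_minimal) auto

lemma span_times_mono: "S \<subseteq> S' \<Longrightarrow> T \<subseteq> T' \<Longrightarrow> S \<odot> T \<subseteq> S' \<odot> T'"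
  by (intro span_times_least subspace_span_times span_timesI) auto

lemma subspace_vimage_mult:
  assumes "subspace U"
  shows "subspace {x. x * y \<in> U}" "subspace {y. x * y \<in> U}"
  using assms by (auto simp: subspace_def distrib_left distrib_right scale_mult_left scale_mult_right)

lemma span_times_span: "span S \<odot> span T = S \<odot> T"
proof (rule antisym)
  have 1: "span T \<subseteq> {y. x * y \<in> S \<odot> T}" if "x \<in> S" for x
    using that by (intro span_minimal subspace_vimage_mult subspace_span_times) (auto intro: span_timesI)
  have "span S \<subseteq> {x. x * y \<in> S \<odot> T}" if "y \<in> span T" for y
    using that 1 by (intro span_minimal subspace_vimage_mult subspace_span_times) auto
  then show "span S \<odot> span T \<subseteq> S \<odot> T" by (intro span_times_least) auto
qed (intro span_times_mono span_superset)

lemma span_times_span_right: "S \<odot> span T = S \<odot> T"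
  by (metis span_times_span span_span)

lemma finite_dimensional_span_times:
  assumes "finite_dimensional S" "finite_dimensional T"
  shows "finite_dimensional (S \<odot> T)"
proof -
  obtain B C where "finite B" "span B = S" "finite C" "span C = T"
    using assms by (auto simp: finite_dimensional_def)
  then have "S \<odot> T = span ((\<lambda>(x, y). x * y) ` (B \<times> C))"
    using span_times_span[of B C] unfolding span_times_def by (auto intro!: arg_cong[of _ _ span])
  then show ?thesis
    using finite_dimensionalI[of "(\<lambda>(x, y). x * y) ` (B \<times> C)"] \<open>finite B\<close> \<open>finite C\<close> by simp
qed

lemma span_times_assoc: "(R \<odot> S) \<odot> T = R \<odot> S \<odot> T"
proof (rule antisym)
  have "x * y \<in> R \<odot> S \<odot> T" if "x \<in> R \<odot> S" "y \<in> T" for x y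
  proof -
    have "R \<odot> S \<subseteq> {x. x * y \<in> R \<odot> S \<odot> T}"
      using \<open>y \<in> T\<close>
      by (intro span_times_least) (auto simp: mult.assoc intro: subspace_vimage_mult span_timesI)
    then show ?thesis using that by auto
  qed
  then show "(R \<odot> S) \<odot> T \<subseteq> R \<odot> S \<odot> T" by (intro span_times_least) auto
  have "x * y \<in> (R \<odot> S) \<odot> T" if "x \<in> R" "y \<in> S \<odot> T" for x y
  proof -
    have "S \<odot> T \<subseteq> {y. x * y \<in> (R \<odot> S) \<odot> T}"
      using \<open>x \<in> R\<close>
      by (intro span_times_least)
        (auto simp: mult.assoc[symmetric] intro: subspace_vimage_mult span_timesI)
    then show ?thesis using that by auto
  qed
  then show "R \<odot> S \<odot> T \<subseteq> (R \<odot> S) \<odot> T" by (intro span_times_least) auto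
qed

lemma span_times_Un: "S \<odot> (T \<union> T') = span (S \<odot> T \<union> S \<odot> T')"
proof (rule antisym)
  show "S \<odot> (T \<union> T') \<subseteq> span (S \<odot> T \<union> S \<odot> T')"
    by (rule span_times_least) (auto intro!: span_base span_timesI)
  show "span (S \<odot> T \<union> S \<odot> T') \<subseteq> S \<odot> (T \<union> T')"
    by (intro span_minimal Un_least span_times_mono) auto
qed

lemma span_times_one: "subspace U \<Longrightarrow> {1} \<odot> U = U"
  unfolding span_times_def by (auto simp: span_eq_iff[THEN iffD2])

lemma subspace_space_power: "subspace (space_power V n)"
  unfolding space_power_def by (rule subspace_span)

lemma space_power_0: "space_power V 0 = span {1}"
  unfolding space_power_def by (rule arg_cong[of _ _ span]) auto

lemma space_power_Suc: "space_power V (Suc n) = V \<odot> space_power V n"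
proof -
  have "{prod_list xs |xs. length xs = Suc n \<and> set xs \<subseteq> V}
    = {x * y |x y. x \<in> V \<and> y \<in> {prod_list xs |xs. length xs = n \<and> set xs \<subseteq> V}}"
    (is "?L = ?R")
  proof (rule antisym)
    show "?L \<subseteq> ?R"
    proof safe
      fix xs :: "'a list" assume "length xs = Suc n" "set xs \<subseteq> V"
      then show "\<exists>x y. prod_list xs = x * y \<and> x \<in> V \<and>
        y \<in> {prod_list xs |xs. length xs = n \<and> set xs \<subseteq> V}"
        by (cases xs) auto
    qed
    show "?R \<subseteq> ?L"
    proof safe
      fix x xs assume "x \<in> V" "set xs \<subseteq> V" "n = length xs"
      then show "\<exists>ys. x * prod_list xs = prod_list ys \<and> length ys = Suc (length xs) \<and> set ys \<subseteq> V"
        by (intro exI[of _ "x # xs"]) auto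
    qed
  qed
  then have "space_power V (Suc n) = V \<odot> {prod_list xs |xs. length xs = n \<and> set xs \<subseteq> V}"
    unfolding space_power_def[of V "Suc n"] span_times_def by simp
  then show ?thesis by (simp add: space_power_def[of V n] span_times_span_right)
qed

lemma linear_image_span_times:
  assumes f: "Vector_Spaces.linear scale scale f"
    and comm: "\<And>t x. t \<in> T \<Longrightarrow> f (t * x) = t * f x"
  shows "f ` (T \<odot> U) = T \<odot> f ` U"
proof -
  interpret f: Vector_Spaces.linear scale scale f by (rule f)
  have "f ` {x * y |x y. x \<in> T \<and> y \<in> U} = {x * y |x y. x \<in> T \<and> y \<in> f ` U}"
    using comm by (auto simp: image_iff) metis
  then show ?thesis unfolding span_times_def by (simp add: f.span_image[symmetric])
qed

end

section \<open>Expansion under multiplication\<close>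

context k_algebra
begin

text \<open>The linear form of an inequality of Petridis. When one more image \<open>f U\<close> is added to \<open>Y\<close>, the
  dimension of the sum grows by \<open>dim U - dim Z\<close> for the subspace \<open>Z\<close> of those elements of \<open>U\<close> that
  \<open>f\<close> maps into \<open>Y\<close>. Since \<open>f (T Z) = T f Z\<close> lies both in \<open>T Y\<close> and in \<open>f (T U)\<close>, the dimension of
  \<open>T Y\<close> grows by at most \<open>dim (T U) - dim (T Z)\<close>, and this is at most \<open>r (dim U - dim Z)\<close> because \<open>r\<close> is
  minimal.\<close>

lemma dim_sum_of_translates_le:
  assumes T: "finite_dimensional T" and U: "finite_dimensional U"
    and min: "\<And>Z. subspace Z \<Longrightarrow> Z \<subseteq> U \<Longrightarrow> r * real (dim Z) \<le> real (dim (T \<odot> Z))"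
    and eq: "real (dim (T \<odot> U)) = r * real (dim U)"
    and fin: "finite \<Phi>"
    and lin: "\<And>f. f \<in> \<Phi> \<Longrightarrow> Vector_Spaces.linear scale scale f"
    and inj: "\<And>f. f \<in> \<Phi> \<Longrightarrow> inj f"
    and comm: "\<And>f t x. f \<in> \<Phi> \<Longrightarrow> t \<in> T \<Longrightarrow> f (t * x) = t * f x"
  shows "real (dim (T \<odot> (\<Union>f\<in>\<Phi>. f ` U))) \<le> r * real (dim (\<Union>f\<in>\<Phi>. f ` U))"
proof -
  have "finite_dimensional (span (\<Union>f\<in>\<Phi>. f ` U)) \<and>
    real (dim (T \<odot> (\<Union>f\<in>\<Phi>. f ` U))) \<le> r * real (dim (\<Union>f\<in>\<Phi>. f ` U))"
    using fin lin inj comm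
  proof (induction \<Phi>)
    case empty
    have "T \<odot> {} = span {}" by (simp add: span_times_def)
    have "dim {} = 0" using dim_eq_card_independent[OF independent_empty] by simp
    then have "dim {0} = 0" using dim_span[of "{}", unfolded span_empty] by simp
    with \<open>dim {} = 0\<close> \<open>T \<odot> {} = span {}\<close> show ?case using finite_dimensionalI[of "{}"] by simp
  next
    case (insert f \<Phi>)
    define Y where "Y = span (\<Union>f\<in>\<Phi>. f ` U)"
    have f: "Vector_Spaces.linear scale scale f" "inj f" "\<And>t x. t \<in> T \<Longrightarrow> f (t * x) = t * f x"
      using insert.prems by auto
    interpret f: Vector_Spaces.linear scale scale f by (rule f)
    have Y: "finite_dimensional Y" "real (dim (T \<odot> Y)) \<le> r * real (dim Y)"
      using insert unfolding Y_def by (auto simp: span_times_span_right)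
    have sY: "subspace Y" and sU: "subspace U" using Y U finite_dimensional_subspace by auto
    have TU: "finite_dimensional (T \<odot> U)" and TY: "finite_dimensional (T \<odot> Y)"
      using finite_dimensional_span_times T U Y by auto
    note fU = dim_image_inj[OF k_algebra_axioms k_algebra_axioms f(1,2) U]
      and fTU = dim_image_inj[OF k_algebra_axioms k_algebra_axioms f(1,2) TU]
    define Z where "Z = U \<inter> f -` Y"
    have sZ: "subspace Z" unfolding Z_def using sY sU f.subspace_vimage subspace_inter by blast
    have ZU: "Z \<subseteq> U" by (auto simp: Z_def)
    have Z: "finite_dimensional Z" using finite_dimensional_subset[OF U sZ ZU] .
    have TZ: "finite_dimensional (T \<odot> Z)" using finite_dimensional_span_times T Z by auto
    have fZ: "f ` Z = Y \<inter> f ` U" by (auto simp: Z_def)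
    have eqU: "(\<Union>g\<in>insert f \<Phi>. g ` U) = f ` U \<union> (\<Union>f\<in>\<Phi>. f ` U)" by simp
    have sp: "span (\<Union>g\<in>insert f \<Phi>. g ` U) = span (Y \<union> f ` U)"
      unfolding eqU Y_def by (simp add: span_Un span_eq_iff[THEN iffD2] Un_commute)
    have dimU: "dim (Y \<union> f ` U) + dim Z = dim Y + dim U"
      using dim_Un_Int[OF Y(1) fU(2)] dim_image_inj(1)[OF k_algebra_axioms k_algebra_axioms f(1,2) Z] fZ fU(1) by simp
    have "T \<odot> (Y \<union> f ` U) = span (T \<odot> Y \<union> f ` (T \<odot> U))"
      using linear_image_span_times[OF f(1,3)] by (simp add: span_times_Un)
    moreover have "dim (T \<odot> Y \<union> f ` (T \<odot> U)) + dim (T \<odot> Y \<inter> f ` (T \<odot> U)) = dim (T \<odot> Y) + dim (T \<odot> U)"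
      using dim_Un_Int[OF TY fTU(2)] fTU(1) by simp
    moreover have "dim (T \<odot> Z) \<le> dim (T \<odot> Y \<inter> f ` (T \<odot> U))"
    proof -
      have "f ` (T \<odot> Z) \<subseteq> T \<odot> Y \<inter> f ` (T \<odot> U)"
        using linear_image_span_times[OF f(1,3)] fZ ZU span_times_mono[of T T] by auto
      moreover have "finite_dimensional (T \<odot> Y \<inter> f ` (T \<odot> U))"
        using finite_dimensional_subset[OF TY] subspace_inter
          finite_dimensional_subspace[OF TY] finite_dimensional_subspace[OF fTU(2)] by blast
      ultimately show ?thesis using dim_mono dim_image_inj(1)[OF k_algebra_axioms k_algebra_axioms f(1,2) TZ] by metis
    qed
    ultimately have le: "dim (T \<odot> (Y \<union> f ` U)) + dim (T \<odot> Z) \<le> dim (T \<odot> Y) + dim (T \<odot> U)"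
      by simp
    have "real (dim (T \<odot> (Y \<union> f ` U))) \<le> r * real (dim Y) + r * real (dim U) - r * real (dim Z)"
      using le min[OF sZ ZU] eq Y(2) by linarith
    also have "\<dots> = r * (real (dim Y) + real (dim U) - real (dim Z))"
      by (simp add: algebra_simps)
    also have "real (dim Y) + real (dim U) - real (dim Z) = real (dim (Y \<union> f ` U))"
      using dimU by linarith
    finally have "real (dim (T \<odot> (Y \<union> f ` U))) \<le> r * real (dim (Y \<union> f ` U))" .
    moreover have "finite_dimensional (span (Y \<union> f ` U))"
    proof -
      obtain B C where "finite B" "span B = Y" "finite C" "span C = f ` U"
        using Y(1) fU(2) by (auto simp: finite_dimensional_def)
      moreover from this have "span (Y \<union> f ` U) = span (B \<union> C)"
        by (simp add: span_Un span_eq_iff[THEN iffD2] sY finite_dimensional_subspace[OF fU(2)])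
      ultimately show ?thesis using finite_dimensionalI[of "B \<union> C"] by simp
    qed
    ultimately show ?case using sp by (metis dim_span span_times_span_right)
  qed
  then show ?thesis by blast
qed

text \<open>The minimum exists because the dimensions that occur in the ratios are bounded natural numbers.\<close>

lemma exists_minimal_expansion:
  assumes T: "finite_dimensional T" and U: "finite_dimensional U" "dim U > 0"
  obtains U' r where "subspace U'" "U' \<subseteq> U" "dim U' > 0"
    "real (dim (T \<odot> U')) = r * real (dim U')"
    "\<And>Z. subspace Z \<Longrightarrow> Z \<subseteq> U \<Longrightarrow> r * real (dim Z) \<le> real (dim (T \<odot> Z))"
proof -
  define R where "R = {real (dim (T \<odot> Z)) / real (dim Z) | Z. subspace Z \<and> Z \<subseteq> U \<and> dim Z > 0}"
  have "R \<subseteq> (\<lambda>(a, b). real a / real b) ` ({..dim (T \<odot> U)} \<times> {..dim U})"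
  proof
    fix q assume "q \<in> R"
    then obtain Z where Z: "q = real (dim (T \<odot> Z)) / real (dim Z)" "Z \<subseteq> U" by (auto simp: R_def)
    have "dim Z \<le> dim U" "dim (T \<odot> Z) \<le> dim (T \<odot> U)"
      using dim_mono U(1) Z(2) finite_dimensional_span_times[OF T U(1)] span_times_mono[of T T Z U]
      by auto
    then show "q \<in> (\<lambda>(a, b). real a / real b) ` ({..dim (T \<odot> U)} \<times> {..dim U})"
      using Z(1) by (intro image_eqI[of _ _ "(dim (T \<odot> Z), dim Z)"]) auto
  qed
  then have finR: "finite R" by (rule finite_subset) auto
  have "R \<noteq> {}" using U finite_dimensional_subspace[OF U(1)] by (auto simp: R_def)
  then have "Min R \<in> R" using finR by simp
  then obtain U' where U': "Min R = real (dim (T \<odot> U')) / real (dim U')"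
    "subspace U'" "U' \<subseteq> U" "dim U' > 0" unfolding R_def by blast
  show thesis
  proof (rule that[OF U'(2,3,4)])
    show "real (dim (T \<odot> U')) = Min R * real (dim U')" using U' by simp
    fix Z assume Z: "subspace Z" "Z \<subseteq> U"
    show "Min R * real (dim Z) \<le> real (dim (T \<odot> Z))"
    proof (cases "dim Z > 0")
      case True
      then have "Min R \<le> real (dim (T \<odot> Z)) / real (dim Z)"
        using Z finR by (intro Min_le) (auto simp: R_def)
      then show ?thesis using True by (simp add: field_simps)
    qed simp
  qed
qed

lemma linear_mult:
  "Vector_Spaces.linear scale scale (\<lambda>x. a * x)" "Vector_Spaces.linear scale scale (\<lambda>x. x * a)"
  by (unfold_locales; simp add: distrib_left distrib_right scale_mult_left scale_mult_right)+

lemma span_times_eq_translates: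
  assumes "subspace U"
  shows "span B \<odot> U = span (\<Union>b\<in>B. (\<lambda>x. b * x) ` U)" "U \<odot> span B = span (\<Union>b\<in>B. (\<lambda>x. x * b) ` U)"
proof -
  have "span B \<odot> U = B \<odot> U" "U \<odot> span B = U \<odot> B"
    using span_times_span[of B U] span_times_span[of U B] assms by (simp_all add: span_eq_iff[THEN iffD2])
  then show "span B \<odot> U = span (\<Union>b\<in>B. (\<lambda>x. b * x) ` U)" "U \<odot> span B = span (\<Union>b\<in>B. (\<lambda>x. x * b) ` U)"
    unfolding span_times_def by (auto intro!: arg_cong[of _ _ span])
qed

lemma space_power_commute:
  assumes "\<And>x y. x \<in> W \<Longrightarrow> y \<in> W \<Longrightarrow> x * y = y * x" "x \<in> W" "y \<in> space_power W n"
  shows "x * y = y * x"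
proof -
  have "x * prod_list ys = prod_list ys * x" if "set ys \<subseteq> W" for ys
    using that
  proof (induction ys)
    case (Cons y ys)
    then have "x * y = y * x" "x * prod_list ys = prod_list ys * x" using assms(1,2) by auto
    then show ?case by (metis prod_list.Cons mult.assoc)
  qed simp
  moreover have "subspace {y. x * y = y * x}"
    by (auto simp: subspace_def distrib_left distrib_right scale_mult_left scale_mult_right)
  ultimately have "space_power W n \<subseteq> {y. x * y = y * x}"
    unfolding space_power_def by (intro span_minimal) auto
  then show ?thesis using assms(3) by blast
qed

end

locale division_k_algebra = k_algebra scale
  for scale :: "'k::field \<Rightarrow> 'd::division_ring \<Rightarrow> 'd" (infixr \<open>*s\<close> 75)
begin

lemma inj_mult: "a \<noteq> 0 \<Longrightarrow> inj (\<lambda>x::'d. a * x)" "a \<noteq> 0 \<Longrightarrow> inj (\<lambda>x::'d. x * a)"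
  by (auto simp: inj_on_def)

text \<open>By commutativity, left multiplication by an element of \<open>W\<^sup>m\<close> commutes with left multiplication
  by \<open>W\<close>, and \<open>W\<^sup>m U\<close> is the sum of the images of \<open>U\<close> under multiplication by a basis of \<open>W\<^sup>m\<close>. So
  each further factor \<open>W\<close> multiplies the dimension by at most the minimal ratio \<open>r\<close>.\<close>

lemma dim_space_power_times_le:
  assumes W: "finite_dimensional W" "\<And>x y. x \<in> W \<Longrightarrow> y \<in> W \<Longrightarrow> x * y = y * x"
    and U: "finite_dimensional U" "dim U > 0"
    and eq: "real (dim (W \<odot> U)) = r * real (dim U)"
    and min: "\<And>Z. subspace Z \<Longrightarrow> Z \<subseteq> U \<Longrightarrow> r * real (dim Z) \<le> real (dim (W \<odot> Z))"
  shows "real (dim (space_power W m \<odot> U)) \<le> r ^ m * real (dim U)"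
proof (induction m)
  case 0
  have sU: "subspace U" using U finite_dimensional_subspace by auto
  have "space_power W 0 \<odot> U = {1} \<odot> U"
    using span_times_span[of "{1}" U] sU by (simp add: space_power_0 span_eq_iff[THEN iffD2])
  also have "\<dots> = U" using span_times_one sU .
  finally show ?case by simp
next
  case (Suc m)
  have sU: "subspace U" using U finite_dimensional_subspace by auto
  have "0 \<le> r * real (dim U)" by (simp flip: eq)
  then have r: "r \<ge> 0" using U(2) by (simp add: zero_le_mult_iff)
  obtain B where B: "finite B" "independent B" "B \<subseteq> space_power W m" "span B = space_power W m"
    by (rule finite_dimensional_obtain_basis[OF finite_dimensional_space_power[OF W(1), of m]])
  define \<Phi> where "\<Phi> = (\<lambda>b x. b * x) ` B"
  have 0: "b \<noteq> 0" if "b \<in> B" for b using that B(2) dependent_zero[of B] by auto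
  have un: "(\<Union>f\<in>\<Phi>. f ` U) = (\<Union>b\<in>B. (\<lambda>x. b * x) ` U)" by (simp add: \<Phi>_def)
  have sp: "space_power W m \<odot> U = span (\<Union>f\<in>\<Phi>. f ` U)"
    unfolding un B(4)[symmetric] by (rule span_times_eq_translates[OF sU])
  have "real (dim (W \<odot> (\<Union>f\<in>\<Phi>. f ` U))) \<le> r * real (dim (\<Union>f\<in>\<Phi>. f ` U))"
  proof (rule dim_sum_of_translates_le[OF W(1) U(1) min eq])
    show "finite \<Phi>" using B by (simp add: \<Phi>_def)
    fix f assume "f \<in> \<Phi>"
    then obtain b where b: "b \<in> B" "f = (\<lambda>x. b * x)" by (auto simp: \<Phi>_def)
    show "Vector_Spaces.linear (*s) (*s) f" "inj f"
      using b 0 by (auto intro: linear_mult inj_mult)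
    fix t x assume "t \<in> W"
    then have "t * b = b * t" using space_power_commute[OF W(2)] b B(3) by blast
    then show "f (t * x) = t * f x" by (simp add: b mult.assoc[symmetric])
  qed
  then have "real (dim (W \<odot> space_power W m \<odot> U)) \<le> r * real (dim (space_power W m \<odot> U))"
    unfolding sp by (simp add: span_times_span_right)
  also have "\<dots> \<le> r * (r ^ m * real (dim U))" using Suc r by (rule mult_left_mono)
  finally show ?case by (simp add: space_power_Suc span_times_assoc mult.assoc)
qed

text \<open>By the preceding bound, the minimal ratio \<open>r\<close> of \<open>W\<close> on \<open>U\<close> has \<open>r\<^sup>m \<ge> 2\<close>. The conclusion is
  \<open>dim (W U) \<ge> 2\<^sup>1\<^sup>/\<^sup>m dim U\<close>, written without roots.\<close>

lemma dim_times_power_ge: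
  assumes W: "finite_dimensional W" "\<And>x y. x \<in> W \<Longrightarrow> y \<in> W \<Longrightarrow> x * y = y * x"
    and U: "finite_dimensional U" "dim U > 0"
    and exp: "\<And>Z. subspace Z \<Longrightarrow> Z \<subseteq> U \<Longrightarrow> dim Z > 0 \<Longrightarrow> 2 * dim Z \<le> dim (space_power W m \<odot> Z)"
  shows "2 * dim U ^ m \<le> dim (W \<odot> U) ^ m"
proof -
  obtain U' r where U': "subspace U'" "U' \<subseteq> U" "dim U' > 0"
    and eq: "real (dim (W \<odot> U')) = r * real (dim U')"
    and min: "\<And>Z. subspace Z \<Longrightarrow> Z \<subseteq> U \<Longrightarrow> r * real (dim Z) \<le> real (dim (W \<odot> Z))"
    using exists_minimal_expansion[OF W(1) U] by blast
  have "0 \<le> r * real (dim U')" by (simp flip: eq)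
  then have r: "r \<ge> 0" using U'(3) by (simp add: zero_le_mult_iff)
  have "real (dim (space_power W m \<odot> U')) \<le> r ^ m * real (dim U')"
    using U' finite_dimensional_subset[OF U(1)] min
    by (intro dim_space_power_times_le[OF W _ _ eq]) auto
  moreover have "real (2 * dim U') \<le> real (dim (space_power W m \<odot> U'))"
    using exp[OF U'] by (simp only: of_nat_le_iff)
  ultimately have "2 * real (dim U') \<le> r ^ m * real (dim U')" by simp
  then have "2 \<le> r ^ m" using U'(3) by simp
  then have "2 * real (dim U) ^ m \<le> r ^ m * real (dim U) ^ m" by (rule mult_right_mono) simp
  also have "\<dots> = (r * real (dim U)) ^ m" by (simp add: power_mult_distrib)
  also have "\<dots> \<le> real (dim (W \<odot> U)) ^ m"
    using min[of U] finite_dimensional_subspace[OF U(1)] r by (intro power_mono) auto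
  finally have "real (2 * dim U ^ m) \<le> real (dim (W \<odot> U) ^ m)" by simp
  then show ?thesis by (simp only: of_nat_le_iff)
qed

text \<open>If left multiplication by \<open>T\<close> expands \<open>U\<close> by less than a factor of \<open>2\<close>, it expands the subspace
  \<open>U'\<close> of minimal ratio by at most the same factor, and then also \<open>U' X\<close>, since \<open>U' X\<close> is a sum of
  right translates of \<open>U'\<close>. Only one nonzero \<open>u \<in> U'\<close> is kept on the left-hand side, because
  \<open>dim (T u X)\<close> is what linear independence over a subfield bounds from below.\<close>

lemma exists_right_translates_le:
  assumes T: "finite_dimensional T" and U: "finite_dimensional U" "dim (T \<odot> U) < 2 * dim U"
    and X: "finite_dimensional X"
  obtains u where "u \<in> U" "u \<noteq> 0" "dim (T \<odot> {u} \<odot> X) \<le> 2 * dim (U \<odot> X)"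
proof -
  have "dim U > 0" using U(2) by auto
  then obtain U' r where U': "subspace U'" "U' \<subseteq> U" "dim U' > 0"
    and eq: "real (dim (T \<odot> U')) = r * real (dim U')"
    and min: "\<And>Z. subspace Z \<Longrightarrow> Z \<subseteq> U \<Longrightarrow> r * real (dim Z) \<le> real (dim (T \<odot> Z))"
    using exists_minimal_expansion[OF T U(1)] by blast
  have fU': "finite_dimensional U'" using finite_dimensional_subset[OF U(1) U'(1,2)] .
  obtain u where u: "u \<in> U'" "u \<noteq> 0"
  proof (rule ccontr)
    assume "\<not> thesis"
    then have "U' \<subseteq> span {}" using that by auto
    then show False using dim_le_card[of U' "{}"] U'(3) by simp
  qed
  have "real (dim (T \<odot> U)) < real (2 * dim U)" using U(2) by (simp only: of_nat_less_iff)
  then have "r * real (dim U) < 2 * real (dim U)"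
    using min[OF finite_dimensional_subspace[OF U(1)] subset_refl] by linarith
  then have r: "r \<le> 2" by (auto simp: mult_less_cancel_right)
  obtain B where B: "finite B" "independent B" "span B = X"
    by (rule finite_dimensional_obtain_basis[OF X])
  define \<Phi> where "\<Phi> = (\<lambda>b x. x * b) ` B"
  have 0: "b \<noteq> 0" if "b \<in> B" for b using that B(2) dependent_zero[of B] by auto
  have un: "(\<Union>f\<in>\<Phi>. f ` U') = (\<Union>b\<in>B. (\<lambda>x. x * b) ` U')" by (simp add: \<Phi>_def)
  have sp: "U' \<odot> X = span (\<Union>f\<in>\<Phi>. f ` U')"
    unfolding un B(3)[symmetric] by (rule span_times_eq_translates[OF U'(1)])
  have "real (dim (T \<odot> (\<Union>f\<in>\<Phi>. f ` U'))) \<le> r * real (dim (\<Union>f\<in>\<Phi>. f ` U'))"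
  proof (rule dim_sum_of_translates_le[OF T fU' _ eq])
    show "r * real (dim Z) \<le> real (dim (T \<odot> Z))" if "subspace Z" "Z \<subseteq> U'" for Z
      using min[of Z] that U'(2) by auto
    show "finite \<Phi>" using B by (simp add: \<Phi>_def)
    fix f assume "f \<in> \<Phi>"
    then obtain b where b: "b \<in> B" "f = (\<lambda>x. x * b)" by (auto simp: \<Phi>_def)
    show "Vector_Spaces.linear (*s) (*s) f" "inj f"
      using b 0 by (auto intro: linear_mult inj_mult)
    show "f (t * x) = t * f x" for t x by (simp add: b mult.assoc)
  qed
  then have "real (dim (T \<odot> U' \<odot> X)) \<le> r * real (dim (U' \<odot> X))"
    unfolding sp by (simp add: span_times_span_right)
  also have "\<dots> \<le> 2 * real (dim (U' \<odot> X))" using r by (intro mult_right_mono) auto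
  finally have 1: "dim (T \<odot> U' \<odot> X) \<le> 2 * dim (U' \<odot> X)" by linarith
  have 2: "dim (U' \<odot> X) \<le> dim (U \<odot> X)"
    by (intro dim_mono finite_dimensional_span_times U X span_times_mono U') simp
  have 3: "dim (T \<odot> {u} \<odot> X) \<le> dim (T \<odot> U' \<odot> X)"
    using u by (intro dim_mono finite_dimensional_span_times T fU' X span_times_mono) auto
  show thesis using that[of u] u U'(2) 1 2 3 by auto
qed

end

section \<open>Left linear algebra over a commutative subfield\<close>

text \<open>The coefficients range over a subset of the division ring and not over a type, so the notions of
  linear algebra over it are introduced by hand. Recursion over lists makes the step from \<open>us\<close> to
  \<open>u # us\<close>, the only one that is taken below, hold by definition.\<close>

fun left_combinations :: "'d::division_ring set \<Rightarrow> 'd list \<Rightarrow> 'd set" where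
  "left_combinations F [] = {0}"
| "left_combinations F (u # us) = {f * u + l | f l. f \<in> F \<and> l \<in> left_combinations F us}"

fun left_independent :: "'d::division_ring set \<Rightarrow> 'd list \<Rightarrow> bool" where
  "left_independent F [] \<longleftrightarrow> True"
| "left_independent F (u # us) \<longleftrightarrow> u \<notin> left_combinations F us \<and> left_independent F us"

lemma left_combinations_coordinates:
  assumes "x \<in> left_combinations F us"
  shows "\<exists>c. (\<forall>i<length us. c i \<in> F) \<and> x = (\<Sum>i<length us. c i * us ! i)"
  using assms
proof (induction us arbitrary: x)
  case (Cons u us)
  then obtain f l where fl: "f \<in> F" "l \<in> left_combinations F us" "x = f * u + l" by auto
  then obtain c where c: "\<forall>i<length us. c i \<in> F" "l = (\<Sum>i<length us. c i * us ! i)"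
    using Cons.IH by blast
  show ?case
    using fl c by (intro exI[of _ "case_nat f c"])
      (auto simp: sum.lessThan_Suc_shift less_Suc_eq_0_disj simp del: sum.lessThan_Suc)
qed simp

context division_k_algebra
begin

definition subfield :: "'d set \<Rightarrow> bool" where
  "subfield F \<longleftrightarrow> subalgebra F \<and> (\<forall>x\<in>F. inverse x \<in> F) \<and> (\<forall>x\<in>F. \<forall>y\<in>F. x * y = y * x)"

context
  fixes F assumes F: "subfield F"
begin

lemma subspace_left_combinations: "subspace (left_combinations F us)"
proof (induction us)
  case (Cons u us)
  have sF: "subspace F" using F by (auto simp: subfield_def subalgebra_def)
  show ?case
  proof (rule subspaceI)
    show "0 \<in> left_combinations F (u # us)"
      using subspace_0[OF sF] subspace_0[OF Cons] by force
  next
    fix x y assume "x \<in> left_combinations F (u # us)" "y \<in> left_combinations F (u # us)"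
    then obtain f l f' l' where "x = f * u + l" "y = f' * u + l'" "f \<in> F" "f' \<in> F"
      "l \<in> left_combinations F us" "l' \<in> left_combinations F us" by auto
    then have "x + y = (f + f') * u + (l + l')" "f + f' \<in> F" "l + l' \<in> left_combinations F us"
      using subspace_add[OF sF] subspace_add[OF Cons] by (auto simp: algebra_simps)
    then show "x + y \<in> left_combinations F (u # us)" by auto
  next
    fix c x assume "x \<in> left_combinations F (u # us)"
    then obtain f l where "x = f * u + l" "f \<in> F" "l \<in> left_combinations F us" by auto
    then have "c *s x = (c *s f) * u + c *s l" "c *s f \<in> F" "c *s l \<in> left_combinations F us"
      using subspace_scale[OF sF] subspace_scale[OF Cons] by (auto simp: scale_right_distrib scale_mult_left)
    then show "c *s x \<in> left_combinations F (u # us)" by auto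
  qed
qed (simp add: subspace_single_0)

lemma left_combinations_mult:
  "g \<in> F \<Longrightarrow> x \<in> left_combinations F us \<Longrightarrow> g * x \<in> left_combinations F us"
proof (induction us arbitrary: x)
  case (Cons u us)
  then obtain f l where x: "x = f * u + l" "f \<in> F" "l \<in> left_combinations F us" by auto
  then have "g * l \<in> left_combinations F us" "g * f \<in> F"
    using Cons.IH[OF Cons.prems(1)] Cons.prems(1) F by (auto simp: subfield_def subalgebra_def)
  moreover have "g * x = (g * f) * u + g * l" by (simp only: x(1) distrib_left mult.assoc)
  ultimately show ?case by auto
qed simp

lemma set_subset_left_combinations: "set us \<subseteq> left_combinations F us"
proof (induction us)
  case (Cons u us)
  have F01: "0 \<in> F" "1 \<in> F" using F by (auto simp: subfield_def subalgebra_def subspace_def)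
  have "u \<in> left_combinations F (u # us)"
    using F01(2) subspace_0[OF subspace_left_combinations[of us]] by force
  moreover have "left_combinations F us \<subseteq> left_combinations F (u # us)" using F01(1) by force
  ultimately show ?case using Cons by auto
qed simp

text \<open>The sum of the spaces \<open>T u\<close> over the members \<open>u\<close> of the list is direct: a nonzero element of \<open>T u\<close>
  that is a combination of the other members would, after division by its coefficient in \<open>F\<close>, exhibit
  \<open>u\<close> itself as such a combination.\<close>

lemma dim_times_left_independent:
  assumes T: "finite_dimensional T" "T \<subseteq> F" and us: "left_independent F us"
  shows "length us * dim T \<le> dim (T \<odot> set us)"
  using us
proof (induction us)
  case (Cons u us)
  define R where "R = T \<odot> set us"
  have fR: "finite_dimensional R"
    unfolding R_def using finite_dimensional_span_times[OF T(1) finite_dimensionalI[of "set us"]]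
    by (simp add: span_times_span_right)
  have sT: "subspace T" using T finite_dimensional_subspace by auto
  have RL: "R \<subseteq> left_combinations F us"
    unfolding R_def using T(2) set_subset_left_combinations[of us]
    by (intro span_times_least subspace_left_combinations left_combinations_mult) auto
  have u: "u \<notin> left_combinations F us" using Cons.prems by simp
  then have u0: "u \<noteq> 0" using subspace_0[OF subspace_left_combinations[of us]] by auto
  note Tu = dim_image_inj[OF k_algebra_axioms k_algebra_axioms linear_mult(2)[of u] inj_mult(2)[OF u0] T(1)]
  have "T \<odot> {u} = T \<odot> span {u}" by (simp add: span_times_span_right)
  also have "\<dots> = span ((\<lambda>x. x * u) ` T)" using span_times_eq_translates(2)[OF sT, of "{u}"] by simp
  also have "\<dots> = (\<lambda>x. x * u) ` T"
    using finite_dimensional_subspace[OF Tu(2)] by (simp only: span_eq_iff)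
  finally have "T \<odot> {u} = (\<lambda>x. x * u) ` T" .
  then have "T \<odot> set (u # us) = span ((\<lambda>x. x * u) ` T \<union> R)"
    using span_times_Un[of T "{u}" "set us"] by (simp add: R_def)
  moreover have "(\<lambda>x. x * u) ` T \<inter> R \<subseteq> span {}"
  proof
    fix x assume "x \<in> (\<lambda>x. x * u) ` T \<inter> R"
    then obtain t where t: "x = t * u" "t \<in> F" "t * u \<in> left_combinations F us" using RL T(2) by auto
    have "t = 0"
    proof (rule ccontr)
      assume "t \<noteq> 0"
      have "inverse t \<in> F" using t(2) F by (simp add: subfield_def)
      then have "inverse t * (t * u) \<in> left_combinations F us" using t(3) by (rule left_combinations_mult)
      then show False using u \<open>t \<noteq> 0\<close> by (simp add: mult.assoc[symmetric])
    qed
    then show "x \<in> span {}" using t by simp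
  qed
  then have "dim ((\<lambda>x. x * u) ` T \<inter> R) = 0" using dim_le_card[of _ "{}"] by auto
  ultimately show ?case using dim_Un_Int[OF Tu(2) fR] Tu(1) Cons by (simp add: R_def)
qed simp

end

end

section \<open>The standard identity of matrices\<close>

lemma prod_list_permute:
  fixes xs :: "'a::monoid_mult list"
  assumes "mset xs = mset ys" "\<And>x y. x \<in> set xs \<Longrightarrow> y \<in> set xs \<Longrightarrow> x * y = y * x"
  shows "prod_list xs = prod_list ys"
proof -
  have "fold (*) xs 1 = fold (*) ys 1"
    if "mset xs = mset ys" "\<And>x y. x \<in> set xs \<Longrightarrow> y \<in> set xs \<Longrightarrow> x * y = y * x"
    for xs ys :: "'a list"
  proof (rule fold_permuted_eq[where P = "\<lambda>_. True"])
    fix x y z :: 'a assume "x \<in> set xs" "y \<in> set xs"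
    then have "x * y = y * x" by (rule that(2))
    then show "x * (y * z) = y * (x * z)" by (simp add: mult.assoc[symmetric])
  qed (use that in auto)
  from this[of "rev xs" "rev ys"] show ?thesis
    using assms by (simp add: prod_list.eq_foldr foldr_conv_fold comp_def)
qed

text \<open>A determinant with two equal columns, expanded, with entries in a commuting subset of a ring.
  Composition with the transposition of the two columns matches the even with the odd permutations
  without changing the products, so the argument is valid in characteristic \<open>2\<close> too.\<close>

lemma signed_sum_of_products_eq_0:
  fixes g :: "nat \<Rightarrow> 'e \<Rightarrow> 'd::ring_1"
  assumes comm: "\<And>s t e e'. g s e * g t e' = g t e' * g s e"
    and es: "\<not> distinct es" "length es = N"
  shows "(\<Sum>\<sigma> | \<sigma> permutes {..<N}. of_int (sign \<sigma>) * prod_list (map (\<lambda>t. g (\<sigma> t) (es ! t)) [0..<N])) = 0"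
proof -
  obtain a b where ab: "a < N" "b < N" "a \<noteq> b" "es ! a = es ! b"
    using es by (auto simp: distinct_conv_nth)
  define \<tau> where "\<tau> = transpose a b"
  have \<tau>: "\<tau> permutes {..<N}" "\<tau> \<circ> \<tau> = id" "\<not> evenperm \<tau>"
    using ab unfolding \<tau>_def by (auto intro: permutes_swap_id simp: evenperm_swap)
  define h where "h \<sigma> = prod_list (map (\<lambda>t. g (\<sigma> t) (es ! t)) [0..<N])" for \<sigma>
  have perm: "permutation \<sigma>" if "\<sigma> permutes {..<N}" for \<sigma>
    using that permutation_permutes by blast
  have h: "h (\<sigma> \<circ> \<tau>) = h \<sigma>" for \<sigma>
  proof -
    have "es ! \<tau> t = es ! t" for t using ab by (auto simp: \<tau>_def transpose_def)
    then have "map (\<lambda>t. g ((\<sigma> \<circ> \<tau>) t) (es ! t)) [0..<N] = map (\<lambda>t. g (\<sigma> t) (es ! t)) (map \<tau> [0..<N])"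
      by simp
    also have "mset \<dots> = image_mset (\<lambda>t. g (\<sigma> t) (es ! t)) (mset (map \<tau> [0..<N]))"
      by (simp only: mset_map)
    also have "mset (map \<tau> [0..<N]) = mset [0..<N]"
    proof -
      have "mset (map \<tau> [0..<N]) = mset_set (\<tau> ` {0..<N})"
        using permutes_inj_on[OF \<tau>(1)] by (simp add: image_mset_mset_set)
      also have "\<tau> ` {0..<N} = {0..<N}" using permutes_image[OF \<tau>(1)] by (simp add: lessThan_atLeast0)
      finally show ?thesis by simp
    qed
    finally have "mset (map (\<lambda>t. g ((\<sigma> \<circ> \<tau>) t) (es ! t)) [0..<N]) = mset (map (\<lambda>t. g (\<sigma> t) (es ! t)) [0..<N])"
      by (simp only: mset_map)
    then show ?thesis unfolding h_def by (rule prod_list_permute) (auto simp: comm)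
  qed
  let ?E = "{\<sigma>. \<sigma> permutes {..<N} \<and> evenperm \<sigma>}" and ?O = "{\<sigma>. \<sigma> permutes {..<N} \<and> \<not> evenperm \<sigma>}"
  have fin: "finite {\<sigma>. \<sigma> permutes {..<N}}" by (rule finite_permutations) simp
  have finEO: "finite ?E" "finite ?O" by (rule finite_subset[OF _ fin]; blast)+
  have "{\<sigma>. \<sigma> permutes {..<N}} = ?E \<union> ?O" by blast
  then have "(\<Sum>\<sigma> | \<sigma> permutes {..<N}. of_int (sign \<sigma>) * h \<sigma>) = (\<Sum>\<sigma>\<in>?E \<union> ?O. of_int (sign \<sigma>) * h \<sigma>)"
    by (rule sum.cong) (rule refl)
  also have "\<dots> = (\<Sum>\<sigma>\<in>?E. of_int (sign \<sigma>) * h \<sigma>) + (\<Sum>\<sigma>\<in>?O. of_int (sign \<sigma>) * h \<sigma>)"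
    by (rule sum.union_disjoint[OF finEO]) blast
  also have "(\<Sum>\<sigma>\<in>?E. of_int (sign \<sigma>) * h \<sigma>) = (\<Sum>\<sigma>\<in>?E. h \<sigma>)"
    by (intro sum.cong) (auto simp: sign_def)
  also have "(\<Sum>\<sigma>\<in>?O. of_int (sign \<sigma>) * h \<sigma>) = - (\<Sum>\<sigma>\<in>?O. h \<sigma>)"
    unfolding sum_negf[symmetric] by (intro sum.cong) (auto simp: sign_def)
  also have "(\<Sum>\<sigma>\<in>?O. h \<sigma>) = (\<Sum>\<sigma>\<in>?E. h \<sigma>)"
  proof (rule sum.reindex_bij_witness[of _ "\<lambda>\<sigma>. \<sigma> \<circ> \<tau>" "\<lambda>\<sigma>. \<sigma> \<circ> \<tau>"])
    fix \<sigma> assume "\<sigma> \<in> ?O"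
    then show "\<sigma> \<circ> \<tau> \<in> ?E" "\<sigma> \<circ> \<tau> \<circ> \<tau> = \<sigma>" "h (\<sigma> \<circ> \<tau>) = h \<sigma>"
      using \<tau> perm h by (auto simp: permutes_compose evenperm_comp comp_assoc)
  next
    fix \<sigma> assume "\<sigma> \<in> ?E"
    then show "\<sigma> \<circ> \<tau> \<in> ?O" "\<sigma> \<circ> \<tau> \<circ> \<tau> = \<sigma>"
      using \<tau> perm by (auto simp: permutes_compose evenperm_comp comp_assoc)
  qed
  finally show ?thesis by (simp add: h_def)
qed

text \<open>The usual expansion of a product of matrices as a sum over paths, here for the action on the
  vectors \<open>u i\<close>. The list \<open>p\<close> holds the vertices of the path after its start \<open>i\<close>, and \<open>zip (i # p) p\<close>
  its edges.\<close>

lemma matrix_product_path_expansion: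
  fixes u :: "'i \<Rightarrow> 'd::ring_1" and \<phi> :: "'b \<Rightarrow> 'd"
  assumes I: "finite I" and M: "\<And>b i. i \<in> I \<Longrightarrow> u i * \<phi> b = (\<Sum>l\<in>I. M b i l * u l)"
  shows "i \<in> I \<Longrightarrow> u i * prod_list (map \<phi> bs) =
    (\<Sum>p | set p \<subseteq> I \<and> length p = length bs.
      prod_list (map2 (\<lambda>b (x, y). M b x y) bs (zip (i # p) p)) * u (last (i # p)))"
proof (induction bs arbitrary: i)
  case Nil
  have "{p. set p \<subseteq> I \<and> p = []} = {[]}" by auto
  then show ?case by simp
next
  case (Cons b bs)
  let ?P = "{p. set p \<subseteq> I \<and> length p = length bs}"
  let ?h = "\<lambda>i bs p. prod_list (map2 (\<lambda>b (x, y). M b x y) bs (zip (i # p) p)) * u (last (i # p))"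
  have "{p. set p \<subseteq> I \<and> length p = length (b # bs)} = (\<lambda>(l, p). l # p) ` (I \<times> ?P)"
    by (auto simp: length_Suc_conv image_iff)
  moreover have "inj_on (\<lambda>(l, p). l # p) (I \<times> ?P)" by (auto simp: inj_on_def)
  ultimately have "(\<Sum>p | set p \<subseteq> I \<and> length p = length (b # bs). ?h i (b # bs) p)
      = (\<Sum>(l, p)\<in>I \<times> ?P. ?h i (b # bs) (l # p))"
    by (simp add: sum.reindex case_prod_unfold)
  also have "\<dots> = (\<Sum>l\<in>I. M b i l * (\<Sum>p\<in>?P. ?h l bs p))"
    by (simp add: sum.cartesian_product[symmetric] sum_distrib_left mult.assoc)
  also have "\<dots> = (\<Sum>l\<in>I. M b i l * (u l * prod_list (map \<phi> bs)))"
    using Cons.IH by (intro sum.cong) auto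
  also have "\<dots> = (\<Sum>l\<in>I. M b i l * u l) * prod_list (map \<phi> bs)"
    by (simp add: sum_distrib_right mult.assoc)
  also have "\<dots> = u i * prod_list (map \<phi> (b # bs))"
    unfolding M[OF Cons.prems, symmetric] by (simp add: mult.assoc)
  finally show ?case ..
qed

definition standard_polynomial :: "nat \<Rightarrow> nat list \<Rightarrow>\<^sub>0 'k::field" where
  "standard_polynomial N =
    (\<Sum>\<sigma> | \<sigma> permutes {..<N}. Poly_Mapping.single (map \<sigma> [0..<N]) (of_int (sign \<sigma>)))"

lemma inj_on_permutation_word: "inj_on (\<lambda>\<sigma>. map \<sigma> [0..<N]) {\<sigma>. \<sigma> permutes {..<N}}"
proof (rule inj_onI)
  fix \<sigma> \<tau> assume *: "\<sigma> \<in> {\<sigma>. \<sigma> permutes {..<N}}" "\<tau> \<in> {\<sigma>. \<sigma> permutes {..<N}}"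
    "map \<sigma> [0..<N] = map \<tau> [0..<N]"
  then have "\<sigma> t = \<tau> t" if "t < N" for t using that by (auto simp: map_eq_conv)
  moreover have "\<sigma> t = \<tau> t" if "\<not> t < N" for t
    using that * permutes_not_in[of \<sigma> "{..<N}" t] permutes_not_in[of \<tau> "{..<N}" t] by auto
  ultimately show "\<sigma> = \<tau>" by blast
qed

lemma lookup_standard_polynomial:
  assumes "\<sigma> permutes {..<N}"
  shows "Poly_Mapping.lookup (standard_polynomial N) (map \<sigma> [0..<N]) = (of_int (sign \<sigma>) :: 'k::field)"
proof -
  have fin: "finite {\<sigma>. \<sigma> permutes {..<N}}" by (rule finite_permutations) simp
  have "Poly_Mapping.lookup (standard_polynomial N) (map \<sigma> [0..<N]) =
    (\<Sum>\<tau> | \<tau> permutes {..<N}. if \<tau> = \<sigma> then (of_int (sign \<tau>) :: 'k) else 0)"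
    unfolding standard_polynomial_def lookup_sum
    using assms inj_onD[OF inj_on_permutation_word[of N]]
    by (intro sum.cong refl) (auto simp: lookup_single when_def)
  then show ?thesis using assms fin by (simp add: sum.delta')
qed

lemma standard_polynomial_nonzero: "(standard_polynomial N :: nat list \<Rightarrow>\<^sub>0 'k::field) \<noteq> 0"
proof
  assume "(standard_polynomial N :: nat list \<Rightarrow>\<^sub>0 'k) = 0"
  then show False using lookup_standard_polynomial[of id N, where 'k = 'k] by (simp add: permutes_id)
qed

context k_algebra
begin

lemma scale_sign: "of_int (sign \<sigma>) *s x = of_int (sign \<sigma>) * x"
  by (cases "sign \<sigma> = 1") (auto simp: sign_def split: if_splits)

lemma nc_poly_eval_standard_polynomial:
  "nc_poly_eval (standard_polynomial N) x =
    (\<Sum>\<sigma> | \<sigma> permutes {..<N}. of_int (sign \<sigma>) * prod_list (map (\<lambda>t. x (\<sigma> t)) [0..<N]))"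
proof -
  let ?f = "standard_polynomial N :: nat list \<Rightarrow>\<^sub>0 'k"
  let ?S = "(\<lambda>\<sigma>. map \<sigma> [0..<N]) ` {\<sigma>. \<sigma> permutes {..<N}}"
  have fin: "finite {\<sigma>. \<sigma> permutes {..<N}}" by (rule finite_permutations) simp
  have keys: "Poly_Mapping.keys ?f \<subseteq> ?S"
  proof
    fix w assume "w \<in> Poly_Mapping.keys ?f"
    then have "Poly_Mapping.lookup ?f w \<noteq> 0" by (simp add: in_keys_iff)
    then have "(\<Sum>\<sigma> | \<sigma> permutes {..<N}.
        Poly_Mapping.lookup (Poly_Mapping.single (map \<sigma> [0..<N]) (of_int (sign \<sigma>) :: 'k)) w) \<noteq> 0"
      by (simp only: standard_polynomial_def lookup_sum not_False_eq_True)
    then obtain \<sigma> where "\<sigma> \<in> {\<sigma>. \<sigma> permutes {..<N}}"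
      "Poly_Mapping.lookup (Poly_Mapping.single (map \<sigma> [0..<N]) (of_int (sign \<sigma>) :: 'k)) w \<noteq> 0"
      by (rule sum.not_neutral_contains_not_neutral)
    then show "w \<in> ?S" by (auto simp: lookup_single when_def split: if_splits)
  qed
  have "nc_poly_eval ?f x = (\<Sum>w\<in>?S. Poly_Mapping.lookup ?f w *s prod_list (map x w))"
    unfolding nc_poly_eval_def using keys fin
    by (intro sum.mono_neutral_left) (auto simp: in_keys_iff)
  also have "\<dots> = (\<Sum>\<sigma> | \<sigma> permutes {..<N}.
      Poly_Mapping.lookup ?f (map \<sigma> [0..<N]) *s prod_list (map x (map \<sigma> [0..<N])))"
    by (simp add: sum.reindex[OF inj_on_permutation_word])
  also have "\<dots> = (\<Sum>\<sigma> | \<sigma> permutes {..<N}. of_int (sign \<sigma>) * prod_list (map (\<lambda>t. x (\<sigma> t)) [0..<N]))"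
    by (intro sum.cong refl) (simp add: lookup_standard_polynomial scale_sign comp_def)
  finally show ?thesis .
qed

end

context quotient_division_algebra
begin

lemma embed_prod_list: "\<iota> (prod_list xs) = prod_list (map \<iota> xs)"
  by (induction xs) (simp_all add: embed_one embed_mult)

lemma embed_of_int: "\<iota> (of_int k * x) = of_int k * \<iota> x"
proof (induction k)
  case (nonneg n)
  show ?case by (induction n) (simp_all add: add distrib_right zero)
next
  case negative: (neg n)
  have "\<iota> (of_nat m * x) = of_nat m * \<iota> x" for m
    by (induction m) (simp_all add: add distrib_right zero)
  from this[of "Suc n"] show ?case by (simp add: neg del: of_nat_Suc)
qed

text \<open>The \<open>n\<^sup>2 + 1\<close> steps of a path through \<open>n\<close> vertices use at most \<open>n\<^sup>2\<close> different edges, so each path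
  repeats an edge. In the standard polynomial the contribution of each path to \<open>u i * \<iota> f(x)\<close> is
  then a determinant with two equal columns. Because \<open>D\<close> has no zero divisors, a single nonzero \<open>u i\<close>
  suffices to conclude \<open>f(x) = 0\<close>.\<close>

lemma polynomial_identity_of_matrix_representation:
  fixes u :: "nat \<Rightarrow> 'd"
  assumes M: "\<And>a i. i < n \<Longrightarrow> u i * \<iota> a = (\<Sum>l<n. M a i l * u l)"
    and comm: "\<And>a i l a' i' l'. M a i l * M a' i' l' = M a' i' l' * M a i l"
    and u: "i < n" "u i \<noteq> 0"
  shows "A.satisfies_polynomial_identity"
proof -
  define N where "N = Suc (n * n)"
  let ?f = "standard_polynomial N :: nat list \<Rightarrow>\<^sub>0 'k"
  have "A.nc_poly_eval ?f x = 0" for x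
  proof -
    let ?S = "{\<sigma>. \<sigma> permutes {..<N}}"
    let ?P = "{p. set p \<subseteq> {..<n} \<and> length p = N}"
    let ?g = "\<lambda>t e. M (x t) (fst e) (snd e)"
    have "u i * \<iota> (A.nc_poly_eval ?f x) = (\<Sum>\<sigma>\<in>?S. of_int (sign \<sigma>) * (u i * prod_list (map (\<iota> \<circ> x) (map \<sigma> [0..<N]))))"
      unfolding A.nc_poly_eval_standard_polynomial sum embed_of_int embed_prod_list sum_distrib_left
    proof (intro sum.cong refl)
      fix \<sigma>
      show "u i * (of_int (sign \<sigma>) * prod_list (map \<iota> (map (\<lambda>t. x (\<sigma> t)) [0..<N]))) =
        of_int (sign \<sigma>) * (u i * prod_list (map (\<iota> \<circ> x) (map \<sigma> [0..<N])))"
        unfolding mult.assoc[symmetric] mult_of_int_commute[of "sign \<sigma>" "u i", symmetric]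
        by (simp add: comp_def)
    qed
    also have "\<dots> = (\<Sum>\<sigma>\<in>?S. of_int (sign \<sigma>) *
        (\<Sum>p\<in>?P. prod_list (map (\<lambda>t. ?g (\<sigma> t) (zip (i # p) p ! t)) [0..<N]) * u (last (i # p))))"
    proof (intro sum.cong refl arg_cong2[of _ _ _ _ "(*)"])
      fix \<sigma>
      have "u i * prod_list (map (\<iota> \<circ> x) (map \<sigma> [0..<N])) =
        (\<Sum>p | set p \<subseteq> {..<n} \<and> length p = length (map \<sigma> [0..<N]).
          prod_list (map2 (\<lambda>b (y, z). M (x b) y z) (map \<sigma> [0..<N]) (zip (i # p) p)) * u (last (i # p)))"
        using M u by (intro matrix_product_path_expansion[where M = "\<lambda>b. M (x b)"]) auto
      also have "\<dots> = (\<Sum>p\<in>?P. prod_list (map (\<lambda>t. ?g (\<sigma> t) (zip (i # p) p ! t)) [0..<N]) * u (last (i # p)))"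
      proof (intro sum.cong)
        fix p assume "p \<in> ?P"
        then have "map2 (\<lambda>b (y, z). M (x b) y z) (map \<sigma> [0..<N]) (zip (i # p) p) =
          map (\<lambda>t. ?g (\<sigma> t) (zip (i # p) p ! t)) [0..<N]"
          by (intro nth_equalityI) (auto simp: case_prod_unfold)
        then show "prod_list (map2 (\<lambda>b (y, z). M (x b) y z) (map \<sigma> [0..<N]) (zip (i # p) p)) * u (last (i # p))
          = prod_list (map (\<lambda>t. ?g (\<sigma> t) (zip (i # p) p ! t)) [0..<N]) * u (last (i # p))" by simp
      qed simp
      finally show "u i * prod_list (map (\<iota> \<circ> x) (map \<sigma> [0..<N])) =
        (\<Sum>p\<in>?P. prod_list (map (\<lambda>t. ?g (\<sigma> t) (zip (i # p) p ! t)) [0..<N]) * u (last (i # p)))" .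
    qed
    also have "\<dots> = (\<Sum>p\<in>?P. (\<Sum>\<sigma>\<in>?S. of_int (sign \<sigma>) *
        prod_list (map (\<lambda>t. ?g (\<sigma> t) (zip (i # p) p ! t)) [0..<N])) * u (last (i # p)))"
      unfolding sum_distrib_left sum_distrib_right by (subst sum.swap) (simp add: mult.assoc)
    also have "\<dots> = 0"
    proof (intro sum.neutral ballI)
      fix p assume p: "p \<in> ?P"
      have "e \<in> {..<n} \<times> {..<n}" if "e \<in> set (zip (i # p) p)" for e
      proof -
        have "(fst e, snd e) \<in> set (zip (i # p) p)" using that by simp
        then have "fst e \<in> set (i # p)" "snd e \<in> set p" by (rule set_zip_leftD, rule set_zip_rightD)
        then show ?thesis using p u by (auto simp: mem_Times_iff)
      qed
      then have "set (zip (i # p) p) \<subseteq> {..<n} \<times> {..<n}" by blast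
      then have "card (set (zip (i # p) p)) \<le> n * n"
        using card_mono[of "{..<n} \<times> {..<n}"] by (simp add: card_cartesian_product)
      moreover have len: "length (zip (i # p) p) = N" using p by simp
      ultimately have "\<not> distinct (zip (i # p) p)"
        using distinct_card[of "zip (i # p) p"] by (auto simp: N_def)
      from signed_sum_of_products_eq_0[OF _ this len, of ?g] comm
      show "(\<Sum>\<sigma>\<in>?S. of_int (sign \<sigma>) *
        prod_list (map (\<lambda>t. ?g (\<sigma> t) (zip (i # p) p ! t)) [0..<N])) * u (last (i # p)) = 0" by simp
    qed
    finally have "\<iota> (A.nc_poly_eval ?f x) = 0" using u by simp
    then show ?thesis using embed_inj zero by (metis injD)
  qed
  then show ?thesis
    unfolding A.satisfies_polynomial_identity_def using standard_polynomial_nonzero by blast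
qed

end

section \<open>Asymptotics\<close>

lemma powr_ln_ln_asymptotics:
  fixes g d :: real
  assumes "g > 0" "d > 0"
  shows "eventually (\<lambda>x. (2 * x * ((ln x)^2 + 1)) powr g < 2 powr ((ln x)^2)) at_top"
    and "eventually (\<lambda>x. 2 * 2 powr g * ((ln x)^2 + 1) powr g < x powr d) at_top"
  using assms by real_asymp+

text \<open>If \<open>a\<close> grows more slowly than \<open>n\<^sup>g\<close>, and \<open>b m > m\<^sup>c\<close> for arbitrarily large \<open>m\<close> with \<open>c > g - 1\<close>, then
  \<open>j = \<lceil>(ln m)\<^sup>2\<rceil>\<close> works: \<open>2\<^sup>j\<close> grows faster than every power of \<open>m\<close>, whereas the factor \<open>j\<close> that
  separates \<open>m j\<close> from \<open>m\<close> is smaller than every positive power of \<open>m\<close>.\<close>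

lemma growth_comparison:
  fixes a b :: "nat \<Rightarrow> nat" and c g :: real
  assumes g: "g > 0" "g < c + 1"
    and pos: "\<And>n. a n \<ge> 1" "\<And>n. b n \<ge> 1"
    and a: "eventually (\<lambda>n. ln (real (a n)) / ln (real n) < g) sequentially"
    and b: "frequently (\<lambda>n. c < ln (real (b n)) / ln (real n)) sequentially"
  shows "\<exists>m>0. \<exists>j. a (2 * (m * j)) < 2 ^ j \<and> 2 * a (2 * (m * j)) < Suc (m * j) * b m"
proof -
  obtain N where N: "\<And>n. n \<ge> N \<Longrightarrow> ln (real (a n)) / ln (real n) < g"
    using a by (auto simp: eventually_sequentially)
  have "eventually (\<lambda>m. (2 * real m * ((ln (real m))^2 + 1)) powr g < 2 powr ((ln (real m))^2)
      \<and> 2 * 2 powr g * ((ln (real m))^2 + 1) powr g < real m powr (c + 1 - g)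
      \<and> m \<ge> N \<and> m \<ge> 3) sequentially"
    using g powr_ln_ln_asymptotics[of g "c + 1 - g"]
    by (intro eventually_conj eventually_compose_filterlim[OF _ filterlim_real_sequentially] eventually_ge_at_top) auto
  from frequently_eventually_conj[OF b this] obtain m where m: "c < ln (real (b m)) / ln (real m)"
    "(2 * real m * ((ln (real m))^2 + 1)) powr g < 2 powr ((ln (real m))^2)"
    "2 * 2 powr g * ((ln (real m))^2 + 1) powr g < real m powr (c + 1 - g)"
    "m \<ge> N" "m \<ge> 3"
    by (auto dest!: frequently_ex)
  define j where "j = nat \<lceil>(ln (real m))^2\<rceil>"
  have j: "(ln (real m))^2 \<le> real j" "real j \<le> (ln (real m))^2 + 1"
    unfolding j_def using of_int_ceiling_le_add_one[of "(ln (real m))^2"] by (auto simp: real_nat_ceiling_ge)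
  have "exp 1 \<le> real m" using exp_le m(5) by linarith
  then have lnm: "ln (real m) \<ge> 1" using m(5) by (simp add: ln_ge_iff)
  then have "(ln (real m))^2 > 0" by simp
  then have j1: "j \<ge> 1" using j(1) by linarith
  define n where "n = 2 * (m * j)"
  have mj: "m \<le> m * j" using mult_le_mono2[OF j1, of m] by simp
  then have n: "n \<ge> N" "n \<ge> 2" using m(4,5) unfolding n_def by linarith+
  have "ln (real (a n)) < g * ln (real n)"
    using N[OF n(1)] n(2) by (simp add: field_simps)
  then have an: "real (a n) < real n powr g"
    using pos(1)[of n] n(2) by (simp add: ln_powr[symmetric] ln_less_cancel_iff del: ln_powr)
  have "c * ln (real m) < ln (real (b m))" using m(1) lnm by (simp add: field_simps)
  then have bm: "real m powr c < real (b m)"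
    using pos(2)[of m] m(5) by (simp add: ln_powr[symmetric] ln_less_cancel_iff del: ln_powr)
  have rn: "real n = 2 * real m * real j" by (simp add: n_def)
  have "real n powr g \<le> (2 * real m * ((ln (real m))^2 + 1)) powr g"
    unfolding rn using g j by (intro powr_mono2 mult_left_mono) auto
  also have "\<dots> < 2 powr ((ln (real m))^2)" by (rule m)
  also have "\<dots> \<le> 2 powr real j" using j by simp
  also have "\<dots> = 2 ^ j" by (simp add: powr_realpow)
  finally have "real (a n) < 2 ^ j" using an by linarith
  then have "real (a n) < real (2 ^ j)" by (simp only: of_nat_power of_nat_numeral)
  then have 1: "a n < 2 ^ j" by (simp only: of_nat_less_iff)
  have "2 * real n powr g = real m powr g * (2 * 2 powr g * real j powr g)"
    unfolding rn by (simp add: powr_mult)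
  also have "\<dots> \<le> real m powr g * (2 * 2 powr g * ((ln (real m))^2 + 1) powr g)"
    using g j by (intro mult_left_mono powr_mono2) auto
  also have "\<dots> \<le> real m powr g * real m powr (c + 1 - g)"
    using m(3) by (intro mult_left_mono) auto
  also have "\<dots> = real m * real m powr c"
    using m(5) by (simp add: powr_add[symmetric] powr_mult_base add.commute)
  also have "\<dots> \<le> real m * real (b m)" using bm by (intro mult_left_mono) auto
  also have "\<dots> \<le> real (Suc (m * j)) * real (b m)"
  proof -
    have "m \<le> Suc (m * j)" using mj by (rule le_SucI)
    then show ?thesis by (intro mult_right_mono) (simp_all only: of_nat_le_iff of_nat_0_le_iff)
  qed
  finally have "2 * real (a n) < real (Suc (m * j)) * real (b m)" using an by linarith
  then have "real (2 * a n) < real (Suc (m * j) * b m)" by (simp only: of_nat_mult of_nat_numeral)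
  then have 2: "2 * a n < Suc (m * j) * b m" by (simp only: of_nat_less_iff)
  show ?thesis
    using 1 2 m(5) unfolding n_def by (intro exI[of _ m] conjI exI[of _ j]) auto
qed

section \<open>Powers of a generating space in the quotient division algebra\<close>

lemma left_combinations_least:
  assumes "0 \<in> S" "\<And>x y. x \<in> S \<Longrightarrow> y \<in> S \<Longrightarrow> x + y \<in> S"
    and "\<And>f x. f \<in> F \<Longrightarrow> x \<in> S \<Longrightarrow> f * x \<in> S" and "set us \<subseteq> S"
  shows "left_combinations F us \<subseteq> S"
  using assms(4)
proof (induction us)
  case (Cons u us)
  then show ?case using assms(2,3) by auto
qed (use assms(1) in simp)

lemma mult_inverse_commute:
  fixes x y :: "'d::division_ring"
  assumes "x * y = y * x"
  shows "inverse x * y = y * inverse x"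
proof (cases "x = 0")
  case False
  have "inverse x * y = inverse x * (y * x) * inverse x" using False by (simp add: mult.assoc)
  also have "\<dots> = inverse x * (x * y) * inverse x" by (simp only: assms)
  also have "\<dots> = y * inverse x" using False by (simp add: mult.assoc[symmetric])
  finally show ?thesis .
qed simp

context division_k_algebra
begin

text \<open>The bicommutant is closed under inverses like every commutant. Since \<open>K\<close> is contained in its own
  commutant, the bicommutant is contained in the commutant and therefore commutative.\<close>

lemma commutative_subset_of_subfield:
  assumes "\<And>x y. x \<in> K \<Longrightarrow> y \<in> K \<Longrightarrow> x * y = y * x"
  obtains F where "subfield F" "K \<subseteq> F"
proof
  define F where "F = {x. \<forall>y. (\<forall>z\<in>K. y * z = z * y) \<longrightarrow> x * y = y * x}"
  show "K \<subseteq> F" unfolding F_def by auto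
  have comm: "x * z = z * x" if "x \<in> F" "z \<in> K" for x z
    using that assms unfolding F_def by blast
  show "subfield F"
    unfolding subfield_def subalgebra_def subspace_def
  proof (intro conjI ballI allI)
    fix x y assume "x \<in> F" "y \<in> F"
    then show "x * y \<in> F" unfolding F_def by (auto simp: mult.assoc) (metis mult.assoc)
    show "x * y = y * x" using \<open>x \<in> F\<close> comm[OF \<open>y \<in> F\<close>] unfolding F_def by blast
  qed (auto simp: F_def distrib_left distrib_right scale_mult_left scale_mult_right mult_inverse_commute)
qed

end

sublocale quotient_division_algebra \<subseteq> D: division_k_algebra scaleD
  by unfold_locales

context quotient_division_algebra
begin

text \<open>The left Ore condition provides common left multiples of denominators.\<close>

lemma common_left_denominator:
  assumes "finite B"
  shows "\<exists>s. s \<noteq> 0 \<and> (\<forall>b\<in>B. \<iota> s * b \<in> range \<iota>)"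
  using assms
proof (induction B)
  case empty
  then show ?case by (intro exI[of _ 1]) auto
next
  case (insert d B)
  then obtain s where s: "s \<noteq> 0" "\<And>b. b \<in> B \<Longrightarrow> \<iota> s * b \<in> range \<iota>" by blast
  obtain a t where t: "t \<noteq> 0" "d = inverse (\<iota> t) * \<iota> a" using left_fraction[of d] by blast
  obtain p q where pq: "q \<noteq> 0" "q * t = p * s" using left_ore[OF s(1), of t] by blast
  have nz: "\<iota> t \<noteq> 0" using t(1) embed_inj zero by (metis injD)
  have "\<iota> (q * t) * d = \<iota> (q * a)" using nz by (simp add: t(2) embed_mult mult.assoc[symmetric]) (simp add: mult.assoc nz)
  moreover have "\<iota> (q * t) * b \<in> range \<iota>" if b: "b \<in> B" for b
  proof -
    obtain c where "\<iota> s * b = \<iota> c" using s(2)[OF b] by blast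
    then have "\<iota> (q * t) * b = \<iota> (p * c)" by (simp add: pq(2) embed_mult mult.assoc)
    then show ?thesis by simp
  qed
  ultimately show ?case using pq(1) t(1) by (intro exI[of _ "q * t"]) auto
qed

lemma dim_embed:
  assumes "A.finite_dimensional V"
  shows "D.dim (\<iota> ` V) = A.dim V" "D.finite_dimensional (\<iota> ` V)"
  using dim_image_inj[OF A.k_algebra_axioms D.k_algebra_axioms linear_axioms embed_inj assms] .

lemma embed_space_power: "\<iota> ` A.space_power V n = D.space_power (\<iota> ` V) n"
proof -
  have "\<iota> ` {prod_list xs |xs. length xs = n \<and> set xs \<subseteq> V}
      = {prod_list ys |ys. length ys = n \<and> set ys \<subseteq> \<iota> ` V}" (is "?L = ?R")
  proof (rule antisym)
    show "?L \<subseteq> ?R"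
    proof
      fix y assume "y \<in> ?L"
      then obtain xs where "y = \<iota> (prod_list xs)" "length xs = n" "set xs \<subseteq> V" by auto
      then show "y \<in> ?R" by (intro CollectI exI[of _ "map \<iota> xs"]) (auto simp: embed_prod_list)
    qed
    show "?R \<subseteq> ?L"
    proof
      fix y assume "y \<in> ?R"
      then obtain ys where ys: "y = prod_list ys" "length ys = n" "set ys \<subseteq> \<iota> ` V" by auto
      define xs where "xs = map (inv_into V \<iota>) ys"
      have "inv_into V \<iota> z \<in> V" "\<iota> (inv_into V \<iota> z) = z" if "z \<in> set ys" for z
        using that ys(3) inv_into_into[of z \<iota> V] f_inv_into_f[of z \<iota> V] by blast+
      then have "set xs \<subseteq> V" "map \<iota> xs = ys" "length xs = n"
        using ys(2) by (auto simp: xs_def intro: map_idI)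
      then show "y \<in> ?L" using ys(1) embed_prod_list[of xs]
        by (intro image_eqI[of _ _ "prod_list xs"] CollectI exI[of _ xs]) simp_all
    qed
  qed
  then show ?thesis unfolding A.space_power_def D.space_power_def by (simp only: span_image[symmetric])
qed

text \<open>If no element of \<open>u V\<^sup>n\<^sup>+\<^sup>1\<close> extends the list found in \<open>u V\<^sup>n\<close>, then the left \<open>F\<close>-space \<open>L\<close> spanned
  by the list is mapped into itself by right multiplication with \<open>V\<close> and hence with \<open>A\<close>. Coordinates
  of this action with respect to the list are matrices over \<open>F\<close>.\<close>

lemma exists_left_independent_translates:
  assumes PI: "\<not> A.satisfies_polynomial_identity"
    and V: "A.generating_space UNIV V" and F: "D.subfield F" and u: "u \<noteq> 0"
  shows "\<exists>us. length us = Suc n \<and> set us \<subseteq> D.span_times {u} (D.space_power (\<iota> ` V) n)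
    \<and> left_independent F us"
proof (induction n)
  case 0
  have "1 \<in> D.space_power (\<iota> ` V) 0" by (simp add: D.space_power_0 D.span_base)
  then have "u * 1 \<in> D.span_times {u} (D.space_power (\<iota> ` V) 0)" by (intro D.span_timesI) auto
  then show ?case using u by (intro exI[of _ "[u]"]) auto
next
  case (Suc n)
  let ?P = "D.space_power (\<iota> ` V)"
  have V1: "1 \<in> \<iota> ` V" using V embed_one by (force simp: A.generating_space_def)
  from Suc obtain us where us: "length us = Suc n" "set us \<subseteq> D.span_times {u} (?P n)"
    "left_independent F us" by blast
  have mono: "D.span_times {u} (?P n) \<subseteq> D.span_times {u} (?P (Suc n))"
    by (intro D.span_times_mono D.space_power_mono_exp V1) auto
  let ?L = "left_combinations F us"
  have "\<exists>x\<in>D.span_times {u} (?P (Suc n)). x \<notin> ?L"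
  proof (rule ccontr)
    assume "\<not> (\<exists>x\<in>D.span_times {u} (?P (Suc n)). x \<notin> ?L)"
    then have sub: "D.span_times {u} (?P (Suc n)) \<subseteq> ?L" by blast
    note sL = D.subspace_left_combinations[OF F, of us]
    have stepV: "x * \<iota> v \<in> ?L" if x: "x \<in> ?L" and v: "v \<in> V" for x v
    proof -
      have "?L \<subseteq> {x. x * \<iota> v \<in> ?L}"
      proof (rule left_combinations_least)
        show "set us \<subseteq> {x. x * \<iota> v \<in> ?L}"
        proof
          fix y assume "y \<in> set us"
          then have "y * \<iota> v \<in> D.span_times (D.span_times {u} (?P n)) (?P 1)"
            using us(2) v D.subset_space_power_1[of "\<iota> ` V"] by (intro D.span_timesI) auto
          also have "\<dots> = D.span_times {u} (D.span_times (?P n) (?P 1))" by (rule D.span_times_assoc)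
          also have "\<dots> \<subseteq> D.span_times {u} (?P (Suc n))"
          proof (intro D.span_times_mono D.span_times_least)
            fix p q assume "p \<in> ?P n" "q \<in> ?P 1"
            then show "p * q \<in> ?P (Suc n)" using D.space_power_mult[of p _ n q 1] by simp
          qed (simp_all add: D.subspace_space_power)
          finally show "y \<in> {x. x * \<iota> v \<in> ?L}" using sub by auto
        qed
      qed (auto simp: distrib_right mult.assoc D.subspace_0[OF sL] D.subspace_add[OF sL]
          D.left_combinations_mult[OF F])
      then show ?thesis using x by blast
    qed
    define S where "S = {a. \<forall>x\<in>?L. x * \<iota> a \<in> ?L}"
    have "A.subalgebra S"
      unfolding A.subalgebra_def A.subspace_def S_def
      by (auto simp: zero add scale embed_one embed_mult distrib_left mult.assoc[symmetric]
          D.scale_mult_right D.subspace_0[OF sL] D.subspace_add[OF sL] D.subspace_scale[OF sL])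
    moreover have "V \<subseteq> S" using stepV by (auto simp: S_def)
    ultimately have "A.subalgebra hull V \<subseteq> S" by (intro hull_minimal)
    then have all: "x * \<iota> a \<in> ?L" if "x \<in> ?L" for x a
      using V that by (auto simp: A.generating_space_def S_def)
    have "\<exists>c. (\<forall>l<length us. c l \<in> F) \<and> us ! i * \<iota> a = (\<Sum>l<length us. c l * us ! l)"
      if "i < length us" for a i
      using that D.set_subset_left_combinations[OF F, of us]
      by (intro left_combinations_coordinates all) (auto simp: subset_iff)
    note ex = this
    define M where "M a i = (SOME c. (\<forall>l<length us. c l \<in> F) \<and> us ! i * \<iota> a = (\<Sum>l<length us. c l * us ! l))"
      for a i
    have M: "\<And>a i l. i < length us \<Longrightarrow> l < length us \<Longrightarrow> M a i l \<in> F"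
      "\<And>a i. i < length us \<Longrightarrow> us ! i * \<iota> a = (\<Sum>l<length us. M a i l * us ! l)"
      using someI_ex[OF ex] unfolding M_def by auto
    \<comment> \<open>Outside the range of the indices the coefficients are set to \<open>0\<close>, so that all of them commute.\<close>
    define M' where "M' a i l = (if i < length us \<and> l < length us then M a i l else 0)" for a i l
    have "us ! 0 \<noteq> 0"
    proof (cases us)
      case (Cons y ys)
      then show ?thesis using us(3) D.subspace_0[OF D.subspace_left_combinations[OF F, of ys]] by auto
    qed (use us in simp)
    moreover have "us ! i * \<iota> a = (\<Sum>l<length us. M' a i l * us ! l)" if "i < length us" for i a
      unfolding M(2)[OF that] M'_def using that by (intro sum.cong) auto
    moreover have "M' a i l * M' a' i' l' = M' a' i' l' * M' a i l" for a i l a' i' l'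
      using M(1) F unfolding M'_def D.subfield_def by auto
    moreover have "0 < length us" using us(1) by simp
    ultimately have "A.satisfies_polynomial_identity"
      by (intro polynomial_identity_of_matrix_representation[where M = M'
            and u = "(!) us" and n = "length us" and i = 0])
    then show False using PI by simp
  qed
  then obtain x where "x \<in> D.span_times {u} (?P (Suc n))" "x \<notin> ?L" by blast
  then show ?case using us mono by (intro exI[of _ "x # us"]) auto
qed

text \<open>The alternatives are distinguished by whether left multiplication by \<open>W\<^sup>m\<close> at least doubles all
  subspaces of the powers \<open>V\<^sup>i\<close> with \<open>i < m j\<close>.\<close>

lemma dim_space_power_dichotomy:
  assumes PI: "\<not> A.satisfies_polynomial_identity"
    and V: "A.generating_space UNIV V" and F: "D.subfield F"
    and W: "D.finite_dimensional W" "W \<subseteq> F"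
    and s: "s \<noteq> 0" "\<And>w. w \<in> W \<Longrightarrow> \<iota> s * w \<in> \<iota> ` V"
    and m: "m > 0"
  shows "2 ^ j \<le> A.dim (A.space_power V (2 * (m * j))) \<or>
    Suc (m * j) * D.dim (D.space_power W m) \<le> 2 * A.dim (A.space_power V (2 * (m * j)))"
proof -
  define n where "n = m * j"
  let ?P = "D.space_power (\<iota> ` V)"
  define T where "T = D.space_power W m"
  have fV: "A.finite_dimensional V" and V1: "1 \<in> V" using V by (auto simp: A.generating_space_def)
  have V1': "1 \<in> \<iota> ` V" using V1 embed_one by force
  have fP: "D.finite_dimensional (?P i)" for i
    by (intro D.finite_dimensional_space_power dim_embed fV)
  have dP: "D.dim (?P i) = A.dim (A.space_power V i)" for i
    unfolding embed_space_power[symmetric] by (intro dim_embed A.finite_dimensional_space_power fV)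
  have dpos: "D.dim (?P i) > 0" for i
    using A.dim_space_power_pos[OF fV V1, of i] by (simp add: dP)
  have Pmono: "D.dim (?P i) \<le> D.dim (?P k)" if "i \<le> k" for i k
    by (intro D.dim_mono fP D.space_power_mono_exp V1' that)
  have fT: "D.finite_dimensional T" unfolding T_def by (intro D.finite_dimensional_space_power W)
  have saF: "D.subalgebra F" using F by (simp add: D.subfield_def)
  have TF: "T \<subseteq> F"
  proof -
    have "prod_list xs \<in> F" if "set xs \<subseteq> W" for xs
      using that W(2) saF by (induction xs) (auto simp: D.subalgebra_def)
    then show ?thesis using saF unfolding T_def D.space_power_def D.subalgebra_def
      by (intro D.span_minimal) auto
  qed
  have commW: "x * y = y * x" if "x \<in> W" "y \<in> W" for x y
    using that W(2) F unfolding D.subfield_def by blast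
  have \<iota>s: "\<iota> s \<noteq> 0" using s(1) embed_inj zero by (metis injD)
  show ?thesis
  proof (cases "\<forall>i<n. \<forall>Z. D.subspace Z \<longrightarrow> Z \<subseteq> ?P i \<longrightarrow> D.dim Z > 0 \<longrightarrow>
      2 * D.dim Z \<le> D.dim (D.span_times T Z)")
    case True
    have step: "2 * D.dim (?P i) ^ m \<le> D.dim (?P (Suc i)) ^ m" if "i < n" for i
    proof -
      have "2 * D.dim (?P i) ^ m \<le> D.dim (D.span_times W (?P i)) ^ m"
        using True that commW unfolding T_def
        by (intro D.dim_times_power_ge W fP dpos) auto
      also have "D.dim (D.span_times W (?P i)) \<le> D.dim (?P (Suc i))"
      proof -
        have fWP: "D.finite_dimensional (D.span_times W (?P i))"
          by (intro D.finite_dimensional_span_times W fP)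
        have "D.span_times W (?P i) \<subseteq> {x. \<iota> s * x \<in> ?P (Suc i)}"
        proof (intro D.span_times_least D.subspace_vimage_mult)
          fix w p assume "w \<in> W" "p \<in> ?P i"
          then show "w * p \<in> {x. \<iota> s * x \<in> ?P (Suc i)}"
            unfolding D.space_power_Suc by (auto simp: mult.assoc[symmetric] intro!: D.span_timesI s(2))
        qed (rule D.subspace_space_power)
        then have "(\<lambda>x. \<iota> s * x) ` D.span_times W (?P i) \<subseteq> ?P (Suc i)" by auto
        then have "D.dim ((\<lambda>x. \<iota> s * x) ` D.span_times W (?P i)) \<le> D.dim (?P (Suc i))"
          by (intro D.dim_mono fP)
        then show ?thesis
          using dim_image_inj(1)[OF D.k_algebra_axioms D.k_algebra_axioms D.linear_mult(1) D.inj_mult(1)[OF \<iota>s] fWP]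
          by simp
      qed
      then have "D.dim (D.span_times W (?P i)) ^ m \<le> D.dim (?P (Suc i)) ^ m"
        by (rule power_mono) simp
      finally show ?thesis .
    qed
    have "2 ^ i \<le> D.dim (?P i) ^ m" if "i \<le> n" for i
      using that
    proof (induction i)
      case 0
      then show ?case using dpos[of 0] by simp
    next
      case (Suc i)
      then show ?case using step[of i] by simp
    qed
    from this[of n] have "(2 ^ j) ^ m \<le> D.dim (?P n) ^ m"
      by (simp add: n_def power_mult[symmetric] mult.commute)
    then have "2 ^ j \<le> D.dim (?P n)" using m by (simp add: power_mono_iff)
    also have "\<dots> \<le> D.dim (?P (2 * n))" by (rule Pmono) simp
    finally show ?thesis by (simp add: dP n_def)
  next
    case False
    then obtain i Z where Z: "i < n" "D.subspace Z" "Z \<subseteq> ?P i" "D.dim (D.span_times T Z) < 2 * D.dim Z"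
      by (auto simp: not_le)
    obtain u where u: "u \<in> Z" "u \<noteq> 0"
      and le: "D.dim (D.span_times T (D.span_times {u} (?P n))) \<le> 2 * D.dim (D.span_times Z (?P n))"
      using D.exists_right_translates_le[OF fT D.finite_dimensional_subset[OF fP Z(2,3)] Z(4) fP] by blast
    obtain us where us: "length us = Suc n" "set us \<subseteq> D.span_times {u} (?P n)" "left_independent F us"
      using exists_left_independent_translates[OF PI V F u(2)] by blast
    have "D.finite_dimensional (D.span_times {u} (?P n))"
      using D.finite_dimensional_span_times[OF D.finite_dimensionalI[of "{u}"] fP[of n]]
        D.span_times_span[of "{u}" "?P n"] D.finite_dimensional_subspace[OF fP[of n]]
      by (simp add: D.span_eq_iff[THEN iffD2])
    then have fin: "D.finite_dimensional (D.span_times T (D.span_times {u} (?P n)))"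
      by (rule D.finite_dimensional_span_times[OF fT])
    have "Suc n * D.dim T \<le> D.dim (D.span_times T (set us))"
      using D.dim_times_left_independent[OF F fT TF us(3)] us(1) by simp
    also have "\<dots> \<le> D.dim (D.span_times T (D.span_times {u} (?P n)))"
      by (intro D.dim_mono fin D.span_times_mono us) simp
    also have "\<dots> \<le> 2 * D.dim (D.span_times Z (?P n))" by (rule le)
    also have "D.dim (D.span_times Z (?P n)) \<le> D.dim (?P (i + n))"
    proof (intro D.dim_mono fP D.span_times_least D.subspace_space_power)
      show "z * p \<in> ?P (i + n)" if "z \<in> Z" "p \<in> ?P n" for z p
        using that Z(3) by (intro D.space_power_mult) auto
    qed
    also have "D.dim (?P (i + n)) \<le> D.dim (?P (2 * n))" using Z(1) by (intro Pmono) simp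
    finally show ?thesis by (simp add: dP n_def T_def)
  qed
qed

lemma growth_exponent_add_1_le:
  assumes PI: "\<not> A.satisfies_polynomial_identity"
    and V: "A.generating_space UNIV V" and F: "D.subfield F"
    and W: "D.finite_dimensional W" "1 \<in> W" "W \<subseteq> F"
    and s: "s \<noteq> 0" "\<And>w. w \<in> W \<Longrightarrow> \<iota> s * w \<in> \<iota> ` V"
  shows "D.growth_exponent W \<le> A.growth_exponent V - 1"
proof (rule ccontr)
  have fV: "A.finite_dimensional V" and V1: "1 \<in> V" using V by (auto simp: A.generating_space_def)
  assume "\<not> ?thesis"
  then have gt: "A.growth_exponent V - 1 < D.growth_exponent W" by simp
  \<comment> \<open>If the inequality fails, there is room for \<open>c\<close> below the growth exponent of \<open>W\<close> and \<open>g\<close> above that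
    of \<open>V\<close> with \<open>g < c + 1\<close>.\<close>
  then obtain c where c: "A.growth_exponent V - 1 < ereal c" "ereal c < D.growth_exponent W"
    using ereal_dense2 by blast
  then have "A.growth_exponent V < ereal (c + 1)"
    by (cases "A.growth_exponent V") (auto simp: one_ereal_def)
  then obtain g where g: "A.growth_exponent V < ereal g" "ereal g < ereal (c + 1)"
    using ereal_dense2 by blast
  have g0: "g > 0" "g < c + 1"
    using order_le_less_trans[OF A.growth_exponent_nonneg[OF fV V1] g(1)] g(2) by simp_all
  have ev: "eventually (\<lambda>n. ln (real (A.dim (A.space_power V n))) / ln (real n) < g) sequentially"
    using Limsup_lessD[OF g(1)[unfolded A.growth_exponent_def]] by simp
  have fr: "frequently (\<lambda>n. c < ln (real (D.dim (D.space_power W n))) / ln (real n)) sequentially"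
  proof (rule ccontr)
    assume "\<not> ?thesis"
    then have "D.growth_exponent W \<le> ereal c"
      unfolding D.growth_exponent_def by (intro Limsup_bounded) (simp add: not_frequently not_less)
    then show False using c(2) by simp
  qed
  obtain m j where "m > 0" "A.dim (A.space_power V (2 * (m * j))) < 2 ^ j"
    "2 * A.dim (A.space_power V (2 * (m * j))) < Suc (m * j) * D.dim (D.space_power W m)"
    using growth_comparison[OF g0 A.dim_space_power_pos[OF fV V1] D.dim_space_power_pos[OF W(1,2)] ev fr] by blast
  then show False using dim_space_power_dichotomy[OF PI V F W(1,3) s, of m j] by auto
qed

lemma exists_generating_space_with_denominator:
  assumes fg: "A.finitely_generated UNIV" and W: "D.finite_dimensional W"
  obtains V s where "A.generating_space UNIV V" "s \<noteq> 0" "\<And>w. w \<in> W \<Longrightarrow> \<iota> s * w \<in> \<iota> ` V"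
proof -
  obtain V0 where V0: "A.finite_dimensional V0" "1 \<in> V0" "A.subalgebra hull V0 = UNIV"
    using fg by (auto simp: A.finitely_generated_iff A.generating_space_def)
  obtain B where B: "finite B" "A.span B = V0" using V0 by (auto simp: A.finite_dimensional_def)
  obtain C where C: "finite C" "D.span C = W" using W by (auto simp: D.finite_dimensional_def)
  obtain s where s: "s \<noteq> 0" "\<forall>c\<in>C. \<iota> s * c \<in> range \<iota>"
    using common_left_denominator[OF C(1)] by blast
  then have "\<forall>c\<in>C. \<exists>a. \<iota> s * c = \<iota> a" by blast
  then obtain a where a: "\<forall>c\<in>C. \<iota> s * c = \<iota> (a c)" by (rule bchoice[THEN exE])
  \<comment> \<open>Enlarging a generating space by the numerators keeps it generating.\<close>
  define V where "V = A.span (B \<union> a ` C)"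
  have V0V: "V0 \<subseteq> V" unfolding V_def B(2)[symmetric] by (intro A.span_mono) simp
  have fV: "A.finite_dimensional V" unfolding V_def using B(1) C(1) by (intro A.finite_dimensionalI) simp
  have "A.subalgebra hull V = UNIV" using V0(3) hull_mono[OF V0V, of A.subalgebra] by auto
  then have gen: "A.generating_space UNIV V"
    using fV V0V V0(2) by (auto simp: A.generating_space_def)
  have "W \<subseteq> {w. \<iota> s * w \<in> \<iota> ` V}"
    unfolding C(2)[symmetric]
  proof (intro D.span_minimal D.subspace_vimage_mult)
    show "C \<subseteq> {w. \<iota> s * w \<in> \<iota> ` V}" using a by (auto simp: V_def intro: A.span_base)
    show "D.subspace (\<iota> ` V)" using D.finite_dimensional_subspace[OF dim_embed(2)[OF fV]] .
  qed
  then show thesis using that[OF gen s(1)] by blast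
qed

text \<open>Every finitely generated subalgebra of \<open>K\<close> is compared with a generating space of \<open>A\<close> of its own;
  this is harmless because the growth exponent does not depend on the generating space.\<close>

theorem GKdim_commutative_subalgebra_le:
  assumes fg: "A.finitely_generated UNIV" and PI: "\<not> A.satisfies_polynomial_identity"
    and K: "\<And>x y. x \<in> K \<Longrightarrow> y \<in> K \<Longrightarrow> x * y = y * x"
  shows "D.GKdim K \<le> A.GKdim UNIV - 1"
  unfolding D.GKdim_def
proof (rule SUP_least)
  fix B assume "B \<in> {B. D.subalgebra B \<and> D.finitely_generated B \<and> B \<subseteq> K}"
  then obtain W where W: "D.generating_space B W" and BK: "B \<subseteq> K"
    by (auto simp: D.finitely_generated_iff)
  then have W': "D.finite_dimensional W" "1 \<in> W" "W \<subseteq> K"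
    using hull_subset[of W D.subalgebra] by (auto simp: D.generating_space_def)
  obtain F where F: "D.subfield F" "K \<subseteq> F" using D.commutative_subset_of_subfield[of K] K by blast
  obtain V s where V: "A.generating_space UNIV V" "s \<noteq> 0" "\<And>w. w \<in> W \<Longrightarrow> \<iota> s * w \<in> \<iota> ` V"
    using exists_generating_space_with_denominator[OF fg W'(1)] by blast
  have "D.growth_exponent W \<le> A.growth_exponent V - 1"
    using growth_exponent_add_1_le[OF PI V(1) F(1) W'(1,2) _ V(2,3)] W'(3) F(2) by blast
  then show "D.fg_GKdim B \<le> A.GKdim UNIV - 1"
    using D.fg_GKdim_eq[OF W] A.fg_GKdim_eq[OF V(1)] A.GKdim_eq_fg_GKdim[OF fg] by simp
qed

end

theorem theorem1p1:
  fixes scaleA :: "'k::field \<Rightarrow> 'a::ore_domain \<Rightarrow> 'a"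
    and scaleD :: "'k \<Rightarrow> 'd::division_ring \<Rightarrow> 'd"
    and \<iota> :: "'a \<Rightarrow> 'd"
    and K :: "'d set"
  assumes "k_algebra scaleA"
    and "k_algebra.finitely_generated scaleA UNIV"
    and "\<not> k_algebra.satisfies_polynomial_identity scaleA"
    and "quotient_division_algebra scaleA scaleD \<iota>"
    and "k_algebra.subalgebra scaleD K"
    and "\<forall>x\<in>K. \<forall>y\<in>K. x * y = y * x"
  shows "k_algebra.GKdim scaleD K \<le> k_algebra.GKdim scaleA UNIV - 1"
  using quotient_division_algebra.GKdim_commutative_subalgebra_le[OF assms(4,2,3)] assms(6) by blast

end
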